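(* Let $I$ be a nonempty denumerable index set, let $\{X_i, i\in I\}$ and $\{Y_i, i\in I\}$ be two mean-zero Gaussian processes such that $$E(X_i-X_j)^2 \le E(Y_i-Y_j)^2 \quad\text{for all } i,j\in I,$$ and let $\{m_i, i\in I\}$ be arbitrary real constants. Then for any real constant $m$ and any $k\in I$, $$E\max\Big\{\sup_{i\in I}\,(X_i+m_i-X_k),\; m\Big\} \le E\max\Big\{\sup_{i\in I}\,(Y_i+m_i-Y_k),\; m\Big\}.$$
   Context: "Denumerable" means countable (finite or countably infinite). A mean-zero Gaussian process indexed by $I$ is a family of real random variables such that every finite linear combination is a (possibly degenerate) centered Gaussian variable. Suprema may take the value $+\infty$, and expectations are taken in $(-\infty,+\infty]$. *)

theory Defs
  imports "HOL-Probability.Probability"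
begin

(* The point mass at 0 is the degenerate case; it has no Lebesgue density. *)
definition centered_gaussian :: "'a measure \<Rightarrow> ('a \<Rightarrow> real) \<Rightarrow> bool" where
  "centered_gaussian M Z \<longleftrightarrow>
     Z \<in> borel_measurable M \<and>
     ((AE \<omega> in M. Z \<omega> = 0) \<or>
      (\<exists>\<sigma>>0. distributed M lborel Z (\<lambda>x. ennreal (normal_density 0 \<sigma> x))))"

definition mean_zero_gaussian_process ::
    "'a measure \<Rightarrow> 'i set \<Rightarrow> ('i \<Rightarrow> 'a \<Rightarrow> real) \<Rightarrow> bool" where
  "mean_zero_gaussian_process M I X \<longleftrightarrow>
     (\<forall>J a. finite J \<longrightarrow> J \<subseteq> I \<longrightarrow>
        centered_gaussian M (\<lambda>\<omega>. \<Sum>i\<in>J. a i * X i \<omega>))"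

(* Expectation of an extended-real random variable as E(Z+) - E(Z-), where e2ennreal
   maps negative values to 0. This is the usual expectation in (-\<infinity>, \<infinity>] whenever
   E(Z-) is finite, in particular for Z bounded below on a probability space. *)
definition ereal_expectation :: "'a measure \<Rightarrow> ('a \<Rightarrow> ereal) \<Rightarrow> ereal" where
  "ereal_expectation M Z =
     enn2ereal (\<integral>\<^sup>+ \<omega>. e2ennreal (Z \<omega>) \<partial>M) - enn2ereal (\<integral>\<^sup>+ \<omega>. e2ennreal (- Z \<omega>) \<partial>M)"

end

(* A Lindeberg-type proof that uses neither Gaussian integration by parts nor a
   factorization of covariance matrices.

   Fix a finite index set J and let lse x = ln (sum of exp (x i)), with Gibbs weights
   p i = exp (x i) / (sum of exp (x j)). Along a direction d, the second derivative of lse is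
   1/2 times the sum of p i * p j * (d i - d j)^2, so for a centered Gaussian vector X
     E lse (x + sqrt h X) = lse x + h/4 * (sum of p i * p j * E (X i - X j)^2) + O(h^(3/2)),
   uniformly in x. Larger increments thus give a larger expectation in one small step, up to
   O(h^(3/2)). The averaging operators f |-> (x |-> E f (x + sqrt t X)) form a semigroup in t (by
   the Cramer-Wold theorem) and those of X commute with those of Y (by Fubini), so 1/h steps
   compare E lse (x + X) with E lse (x + Y) up to O(sqrt h). Letting h -> 0 and then replacing
   lse by lse (b x) / b with b -> infinity compares the expected maxima.

   As E X k = 0, subtracting X k does not change the expectation of a finite maximum, and the
   truncation at m amounts to replacing c k by max (c k) m. Monotone convergence along finite
   sets exhausting I finishes the proof. *)

theory Submission
  imports Defs
begin

section \<open>Centered Gaussian variables\<close>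

text \<open>The scale \<open>\<sigma>\<close> may be 0, which covers the point mass. Both cases of
  \<open>centered_gaussian\<close> thus become one image of the standard normal law, and moments and
  characteristic functions follow without further case splits.\<close>

lemma centered_gaussian_law:
  assumes "prob_space M" "centered_gaussian M Z"
  obtains \<sigma> where "distr M borel Z = distr std_normal_distribution borel (\<lambda>x. \<sigma> * x)"
proof -
  interpret prob_space M by fact
  have Z: "Z \<in> borel_measurable M"
    using assms(2) by (simp add: centered_gaussian_def)
  interpret S: prob_space std_normal_distribution by (rule prob_space_normal_density) simp
  consider "AE \<omega> in M. Z \<omega> = 0"
    | \<sigma> where "\<sigma> > 0" "distributed M lborel Z (normal_density 0 \<sigma>)"
    using assms(2) by (auto simp: centered_gaussian_def)
  then show thesis
  proof cases
    case 1
    have "distr M borel Z = distr M borel (\<lambda>_. 0)"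
      using 1 Z by (intro distr_cong_AE) auto
    also have "\<dots> = distr std_normal_distribution borel (\<lambda>x. 0 * x)"
      by (simp add: distr_const S.distr_const)
    finally show thesis by (rule that)
  next
    case (2 \<sigma>)
    have "distributed std_normal_distribution lborel (\<lambda>x. x) std_normal_density"
      by (auto simp: distributed_def distr_id2)
    from S.normal_density_affine[OF this, of \<sigma> 0] \<open>\<sigma> > 0\<close>
    have "distributed std_normal_distribution lborel (\<lambda>x. \<sigma> * x) (normal_density 0 \<sigma>)"
      by simp
    then have "distr std_normal_distribution lborel (\<lambda>x. \<sigma> * x) = distr M lborel Z"
      using 2(2) by (simp add: distributed_def)
    then have "distr std_normal_distribution borel (\<lambda>x. \<sigma> * x) = distr M borel Z"
      by (simp cong: distr_cong)
    then show thesis by (rule that[OF sym])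
  qed
qed

lemma centered_gaussian_integrable_power:
  assumes "prob_space M" "centered_gaussian M Z"
  shows "integrable M (\<lambda>\<omega>. \<bar>Z \<omega>\<bar> ^ k)"
proof -
  obtain \<sigma> where \<sigma>: "distr M borel Z = distr std_normal_distribution borel (\<lambda>x. \<sigma> * x)"
    using centered_gaussian_law[OF assms] .
  have Z [measurable]: "Z \<in> borel_measurable M"
    using assms(2) by (simp add: centered_gaussian_def)
  have "integrable (distr std_normal_distribution borel (\<lambda>x. \<sigma> * x)) (\<lambda>x. \<bar>x\<bar> ^ k)"
    using integrable_norm[OF integrable_std_normal_distribution_moment[of k]]
    by (subst integrable_distr_eq) (auto simp: abs_mult power_mult_distrib power_abs)
  then show ?thesis
    unfolding \<sigma>[symmetric] by (subst (asm) integrable_distr_eq) auto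
qed

lemma centered_gaussian_integrable:
  assumes "prob_space M" "centered_gaussian M Z"
  shows "integrable M Z"
  using centered_gaussian_integrable_power[OF assms, of 1] assms(2)
  by (auto simp: centered_gaussian_def integrable_norm_iff integrable_abs_iff)

lemma centered_gaussian_expectation:
  assumes "prob_space M" "centered_gaussian M Z"
  shows "integral\<^sup>L M Z = 0"
proof -
  obtain \<sigma> where \<sigma>: "distr M borel Z = distr std_normal_distribution borel (\<lambda>x. \<sigma> * x)"
    using centered_gaussian_law[OF assms] .
  have [measurable]: "Z \<in> borel_measurable M"
    using assms(2) by (simp add: centered_gaussian_def)
  have "integral\<^sup>L M Z = integral\<^sup>L (distr M borel Z) (\<lambda>x. x)"
    by (simp add: integral_distr)
  also have "\<dots> = \<sigma> * (\<integral>x. x \<partial>std_normal_distribution)"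
    unfolding \<sigma> by (simp add: integral_distr)
  also have "\<dots> = 0"
    using integral_std_normal_distribution_moment_odd[of 1] by simp
  finally show ?thesis .
qed

text \<open>The exponent is expressed through the second moment of \<open>Z\<close> itself rather
  than through a scale parameter, so characteristic functions of different multiples of one variable
  combine by adding the values of \<open>s\<^sup>2\<close>.\<close>

lemma centered_gaussian_char:
  assumes "prob_space M" "centered_gaussian M Z"
  shows "(CLINT \<omega>|M. iexp (s * Z \<omega>)) = of_real (exp (- (s\<^sup>2 * (\<integral>\<omega>. (Z \<omega>)\<^sup>2 \<partial>M)) / 2))"
proof -
  obtain \<sigma> where \<sigma>: "distr M borel Z = distr std_normal_distribution borel (\<lambda>x. \<sigma> * x)"
    using centered_gaussian_law[OF assms] .
  have [measurable]: "Z \<in> borel_measurable M"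
    using assms(2) by (simp add: centered_gaussian_def)
  have "(\<integral>\<omega>. (Z \<omega>)\<^sup>2 \<partial>M) = integral\<^sup>L (distr M borel Z) (\<lambda>x. x\<^sup>2)"
    by (simp add: integral_distr)
  also have "\<dots> = \<sigma>\<^sup>2 * (\<integral>x. x\<^sup>2 \<partial>std_normal_distribution)"
    unfolding \<sigma> by (simp add: integral_distr power_mult_distrib)
  also have "\<dots> = \<sigma>\<^sup>2"
    using std_normal_distribution_even_moments(1)[of 1] by (simp add: fact_numeral)
  finally have v: "(\<integral>\<omega>. (Z \<omega>)\<^sup>2 \<partial>M) = \<sigma>\<^sup>2" .
  have "(CLINT \<omega>|M. iexp (s * Z \<omega>)) = (CLINT x|distr M borel Z. iexp (s * x))"
    by (simp add: integral_distr)
  also have "\<dots> = char std_normal_distribution (s * \<sigma>)"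
    unfolding \<sigma> char_def by (simp add: integral_distr mult_ac)
  also have "\<dots> = of_real (exp (- (s\<^sup>2 * \<sigma>\<^sup>2) / 2))"
    by (simp add: char_std_normal_distribution power_mult_distrib)
  finally show ?thesis by (simp add: v)
qed

section \<open>Weighted uniqueness and the Cramer-Wold theorem\<close>

text \<open>Dividing a weight by its integral gives a probability density. The hypothesis at u = 0
  says that both weights have the same integral \<open>c\<close>, so the laws of \<open>U\<close>
  and \<open>V\<close> under the two densities have equal characteristic functions and Levy's
  uniqueness theorem applies.\<close>

lemma weighted_Levy_uniqueness_pos:
  fixes r U :: "'a \<Rightarrow> real" and r' V :: "'b \<Rightarrow> real"
  assumes P: "prob_space P" and Q: "prob_space Q"
    and [measurable]: "r \<in> borel_measurable P" "U \<in> borel_measurable P"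
      "r' \<in> borel_measurable Q" "V \<in> borel_measurable Q"
    and r: "\<And>\<omega>. 1 \<le> r \<omega> \<and> r \<omega> \<le> 3" and r': "\<And>\<omega>. 1 \<le> r' \<omega> \<and> r' \<omega> \<le> 3"
    and eq: "\<And>u. (CLINT \<omega>|P. of_real (r \<omega>) * iexp (u * U \<omega>)) = (CLINT \<omega>|Q. of_real (r' \<omega>) * iexp (u * V \<omega>))"
    and B [measurable]: "B \<in> sets borel"
  shows "(\<integral>\<omega>. r \<omega> * indicator B (U \<omega>) \<partial>P) = (\<integral>\<omega>. r' \<omega> * indicator B (V \<omega>) \<partial>Q)"
proof -
  interpret P: prob_space P by fact
  interpret Q: prob_space Q by fact
  have "\<bar>r \<omega>\<bar> \<le> 3" "\<bar>r' \<omega>'\<bar> \<le> 3" for \<omega> \<omega>'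
    using r[of \<omega>] r'[of \<omega>'] by linarith+
  then have ir: "integrable P r" and ir': "integrable Q r'"
    by (auto intro!: P.integrable_const_bound[of _ 3] Q.integrable_const_bound[of _ 3])
  define c where "c = (\<integral>\<omega>. r \<omega> \<partial>P)"
  have c': "c = (\<integral>\<omega>. r' \<omega> \<partial>Q)"
    using eq[of 0] by (simp add: c_def)
  have "(\<integral>\<omega>. 1 \<partial>P) \<le> c" unfolding c_def
    by (intro integral_mono ir) (use r in auto)
  then have c: "c > 0" by (simp add: P.prob_space)
  define D where "D = distr (density P (\<lambda>\<omega>. ennreal (r \<omega> / c))) borel U"
  define E where "E = distr (density Q (\<lambda>\<omega>. ennreal (r' \<omega> / c))) borel V"
  have r0: "0 \<le> r \<omega> / c" "0 \<le> r' \<omega>' / c" for \<omega> \<omega>'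
    using r[of \<omega>] r'[of \<omega>'] c by auto
  have "prob_space (density P (\<lambda>\<omega>. ennreal (r \<omega> / c)))"
  proof
    have "(\<integral>\<^sup>+\<omega>. ennreal (r \<omega> / c) \<partial>P) = ennreal (\<integral>\<omega>. r \<omega> / c \<partial>P)"
      using ir r0 by (intro nn_integral_eq_integral) auto
    also have "(\<integral>\<omega>. r \<omega> / c \<partial>P) = 1" using c by (simp add: c_def)
    finally show "emeasure (density P (\<lambda>\<omega>. ennreal (r \<omega> / c))) (space (density P (\<lambda>\<omega>. ennreal (r \<omega> / c)))) = 1"
      by (simp add: emeasure_density cong: nn_integral_cong)
  qed
  then have D: "real_distribution D"
    unfolding D_def by (intro prob_space.real_distribution_distr) auto
  have "prob_space (density Q (\<lambda>\<omega>. ennreal (r' \<omega> / c)))"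
  proof
    have "(\<integral>\<^sup>+\<omega>. ennreal (r' \<omega> / c) \<partial>Q) = ennreal (\<integral>\<omega>. r' \<omega> / c \<partial>Q)"
      using ir' r0 by (intro nn_integral_eq_integral) auto
    also have "(\<integral>\<omega>. r' \<omega> / c \<partial>Q) = 1" using c by (simp add: c')
    finally show "emeasure (density Q (\<lambda>\<omega>. ennreal (r' \<omega> / c))) (space (density Q (\<lambda>\<omega>. ennreal (r' \<omega> / c)))) = 1"
      by (simp add: emeasure_density cong: nn_integral_cong)
  qed
  then have E: "real_distribution E"
    unfolding E_def by (intro prob_space.real_distribution_distr) auto
  have "char D u = (CLINT \<omega>|P. of_real (r \<omega>) * iexp (u * U \<omega>)) / c" for u
    unfolding D_def char_def using r0
    by (simp add: integral_distr integral_density scaleR_conv_of_real)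
  moreover have "char E u = (CLINT \<omega>|Q. of_real (r' \<omega>) * iexp (u * V \<omega>)) / c" for u
    unfolding E_def char_def using r0
    by (simp add: integral_distr integral_density scaleR_conv_of_real)
  ultimately have "D = E"
    using eq by (intro Levy_uniqueness D E) (simp add: fun_eq_iff)
  moreover have "(\<integral>x. indicator B x \<partial>D) = (\<integral>\<omega>. r \<omega> * indicator B (U \<omega>) \<partial>P) / c"
    unfolding D_def using r0
    by (subst integral_distr, simp, simp, subst integral_density) simp_all
  moreover have "(\<integral>x. indicator B x \<partial>E) = (\<integral>\<omega>. r' \<omega> * indicator B (V \<omega>) \<partial>Q) / c"
    unfolding E_def using r0
    by (subst integral_distr, simp, simp, subst integral_density) simp_all
  ultimately show ?thesis using c by simp
qed

text \<open>The weights are signed because cosines and sines of linear forms play this role in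
  \<open>char_cylinder_eq\<close>. The claim is the difference between the positive case for
  \<open>2 + r\<close> and twice the positive case for the constant 1, which is where
  \<open>eq1\<close> enters.\<close>

lemma weighted_Levy_uniqueness:
  fixes r U :: "'a \<Rightarrow> real" and r' V :: "'b \<Rightarrow> real"
  assumes P: "prob_space P" and Q: "prob_space Q"
    and m[measurable]: "r \<in> borel_measurable P" "U \<in> borel_measurable P"
      "r' \<in> borel_measurable Q" "V \<in> borel_measurable Q"
    and r: "\<And>\<omega>. \<bar>r \<omega>\<bar> \<le> 1" and r': "\<And>\<omega>. \<bar>r' \<omega>\<bar> \<le> 1"
    and eq1: "\<And>u. (CLINT \<omega>|P. iexp (u * U \<omega>)) = (CLINT \<omega>|Q. iexp (u * V \<omega>))"
    and eq: "\<And>u. (CLINT \<omega>|P. of_real (r \<omega>) * iexp (u * U \<omega>)) = (CLINT \<omega>|Q. of_real (r' \<omega>) * iexp (u * V \<omega>))"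
    and B [measurable]: "B \<in> sets borel"
  shows "(\<integral>\<omega>. r \<omega> * indicator B (U \<omega>) \<partial>P) = (\<integral>\<omega>. r' \<omega> * indicator B (V \<omega>) \<partial>Q)"
proof -
  interpret P: prob_space P by fact
  interpret Q: prob_space Q by fact
  have i: "integrable P (\<lambda>\<omega>. iexp (u * U \<omega>))" "integrable P (\<lambda>\<omega>. of_real (r \<omega>) * iexp (u * U \<omega>))"
     "integrable P (\<lambda>\<omega>. indicator B (U \<omega>) :: real)" "integrable P (\<lambda>\<omega>. r \<omega> * indicator B (U \<omega>))" for u
    by (rule P.integrable_const_bound[of _ 1]; use r in \<open>auto simp: norm_mult indicator_def\<close>)+
  have i': "integrable Q (\<lambda>\<omega>. iexp (u * V \<omega>))" "integrable Q (\<lambda>\<omega>. of_real (r' \<omega>) * iexp (u * V \<omega>))"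
     "integrable Q (\<lambda>\<omega>. indicator B (V \<omega>) :: real)" "integrable Q (\<lambda>\<omega>. r' \<omega> * indicator B (V \<omega>))" for u
    by (rule Q.integrable_const_bound[of _ 1]; use r' in \<open>auto simp: norm_mult indicator_def\<close>)+
  have "(\<integral>\<omega>. 1 * indicat_real B (U \<omega>) \<partial>P) = (\<integral>\<omega>. 1 * indicat_real B (V \<omega>) \<partial>Q)"
    by (rule weighted_Levy_uniqueness_pos[OF P Q, where r = "\<lambda>_. 1" and r' = "\<lambda>_. 1"]) (use eq1 in simp_all)
  \<comment> \<open>Adding 2 turns the signed weights into positive ones, which are densities up to scaling.\<close>
  moreover have "(\<integral>\<omega>. (2 + r \<omega>) * indicator B (U \<omega>) \<partial>P) = (\<integral>\<omega>. (2 + r' \<omega>) * indicator B (V \<omega>) \<partial>Q)"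
  proof (rule weighted_Levy_uniqueness_pos[OF P Q])
    show "(CLINT \<omega>|P. of_real (2 + r \<omega>) * iexp (u * U \<omega>)) = (CLINT \<omega>|Q. of_real (2 + r' \<omega>) * iexp (u * V \<omega>))" for u
      using eq1[of u] eq[of u] i(1,2)[of u] i'(1,2)[of u] by (simp add: distrib_right)
    show "1 \<le> 2 + r \<omega> \<and> 2 + r \<omega> \<le> 3" for \<omega> using r[of \<omega>] by auto
    show "1 \<le> 2 + r' \<omega> \<and> 2 + r' \<omega> \<le> 3" for \<omega> using r'[of \<omega>] by auto
  qed simp_all
  ultimately show ?thesis
    using i(3,4) i'(3,4) by (simp add: distrib_right)
qed

text \<open>Induction over the coordinates in \<open>K\<close>, adding one indicator at a time. The
  earlier indicators times the cosine or sine of the linear form act as a bounded signed weight, and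
  uniqueness in the single variable \<open>U k\<close> brings in the indicator of
  \<open>B k\<close>. The frequencies \<open>a\<close> stay arbitrary because each step uses the
  hypothesis at shifted frequencies.\<close>

lemma char_cylinder_eq:
  fixes U :: "'i \<Rightarrow> 'a \<Rightarrow> real" and V :: "'i \<Rightarrow> 'b \<Rightarrow> real"
  assumes P: "prob_space P" and Q: "prob_space Q" and J: "finite J"
    and U: "\<And>i. i \<in> J \<Longrightarrow> U i \<in> borel_measurable P"
    and V: "\<And>i. i \<in> J \<Longrightarrow> V i \<in> borel_measurable Q"
    and eq: "\<And>a. (CLINT \<omega>|P. iexp (\<Sum>i\<in>J. a i * U i \<omega>)) = (CLINT \<omega>|Q. iexp (\<Sum>i\<in>J. a i * V i \<omega>))"
    and B: "\<And>i. i \<in> J \<Longrightarrow> B i \<in> sets borel"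
    and K: "K \<subseteq> J"
  shows "(CLINT \<omega>|P. of_real (\<Prod>i\<in>K. indicator (B i) (U i \<omega>)) * iexp (\<Sum>i\<in>J. a i * U i \<omega>))
       = (CLINT \<omega>|Q. of_real (\<Prod>i\<in>K. indicator (B i) (V i \<omega>)) * iexp (\<Sum>i\<in>J. a i * V i \<omega>))"
  using finite_subset[OF K J] K
proof (induction K arbitrary: a rule: finite_induct)
  case empty
  then show ?case using eq by simp
next
  case (insert k K)
  interpret P: prob_space P by fact
  interpret Q: prob_space Q by fact
  have k: "k \<in> J" "K \<subseteq> J" using insert.prems by auto
  define w where "w \<omega> = (\<Prod>i\<in>K. indicator (B i) (U i \<omega>) :: real)" for \<omega>
  define w' where "w' \<omega> = (\<Prod>i\<in>K. indicator (B i) (V i \<omega>) :: real)" for \<omega>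
  define S where "S a \<omega> = (\<Sum>i\<in>J. a i * U i \<omega>)" for a \<omega>
  define S' where "S' a \<omega> = (\<Sum>i\<in>J. a i * V i \<omega>)" for a \<omega>
  have ms [measurable]: "S a \<in> borel_measurable P" "S' a \<in> borel_measurable Q" for a
    unfolding S_def [abs_def] S'_def [abs_def] using U V by (auto intro!: borel_measurable_sum)
  have mu [measurable]: "U k \<in> borel_measurable P" "V k \<in> borel_measurable Q" "B k \<in> sets borel"
    using U V B k by auto
  have "(\<lambda>\<omega>. indicator (B i) (U i \<omega>) :: real) \<in> borel_measurable P"
      "(\<lambda>\<omega>. indicator (B i) (V i \<omega>) :: real) \<in> borel_measurable Q" if "i \<in> K" for i
    using U[of i] V[of i] B[of i] k that
    by (auto intro!: measurable_compose[OF _ borel_measurable_indicator])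
  then have mw [measurable]: "w \<in> borel_measurable P" "w' \<in> borel_measurable Q"
    unfolding w_def [abs_def] w'_def [abs_def] by (auto intro!: borel_measurable_prod)
  have w01: "w \<omega> = 0 \<or> w \<omega> = 1" "w' \<omega>' = 0 \<or> w' \<omega>' = 1" for \<omega> \<omega>'
    unfolding w_def w'_def using insert.hyps(1)
    by (induction K rule: finite_induct) (auto simp: indicator_def)
  have w1: "\<bar>w \<omega>\<bar> \<le> 1" "\<bar>w' \<omega>'\<bar> \<le> 1" for \<omega> \<omega>'
    using w01(1)[of \<omega>] w01(2)[of \<omega>'] by auto
  have IH: "(CLINT \<omega>|P. of_real (w \<omega>) * iexp (S a \<omega>)) = (CLINT \<omega>|Q. of_real (w' \<omega>) * iexp (S' a \<omega>))" for a
    using insert.IH[OF k(2), of a] by (simp add: w_def w'_def S_def S'_def)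
  have intP: "integrable P (\<lambda>\<omega>. of_real (w \<omega>) * iexp (S a \<omega>))" for a
    by (rule P.integrable_const_bound[of _ 1]) (auto simp: norm_mult w1)
  have intQ: "integrable Q (\<lambda>\<omega>. of_real (w' \<omega>) * iexp (S' a \<omega>))" for a
    by (rule Q.integrable_const_bound[of _ 1]) (auto simp: norm_mult w1)
  \<comment> \<open>With e the unit frequency at \<open>k\<close>, these are u e + a and u e - a,
    the two frequencies that the product-to-sum formulas below produce.\<close>
  define a1 where "a1 u i = (if i = k then u else 0) + a i" for u i
  define a2 where "a2 u i = (if i = k then u else 0) - a i" for u i
  have a12: "S (a1 u) \<omega> = u * U k \<omega> + S a \<omega>" "S (a2 u) \<omega> = u * U k \<omega> - S a \<omega>"
     "S' (a1 u) \<omega>' = u * V k \<omega>' + S' a \<omega>'" "S' (a2 u) \<omega>' = u * V k \<omega>' - S' a \<omega>'" for u \<omega> \<omega>'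
    using k J by (simp_all add: S_def S'_def a1_def a2_def distrib_right left_diff_distrib sum.distrib
        sum_subtractf if_distrib[of "\<lambda>x. x * _"] cong: if_cong)
  have ee: "(CLINT \<omega>|P. iexp (u * U k \<omega>)) = (CLINT \<omega>|Q. iexp (u * V k \<omega>))" for u
    using eq[of "\<lambda>i. if i = k then u else 0"] k J
    by (simp add: if_distrib[of "\<lambda>x. x * _"] cong: if_cong)
  \<comment> \<open>Product-to-sum formulas: a cosine or sine weight times a character in
    \<open>U k\<close> is a combination of weighted characters at the frequencies
    \<open>a1 u\<close> and \<open>a2 u\<close>, both covered by the induction hypothesis.\<close>
  have cos2: "of_real (x * cos s) * iexp t = (of_real x * iexp (t + s) + of_real x * iexp (t - s)) / 2" for x s t :: real
    unfolding cis_conv_exp[symmetric]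
    by (simp add: complex_eq_iff cos_add cos_diff sin_add sin_diff field_simps)
  have sin2: "of_real (x * sin s) * iexp t = (of_real x * iexp (t + s) - of_real x * iexp (t - s)) * (- \<i> / 2)" for x s t :: real
    unfolding cis_conv_exp[symmetric]
    by (simp add: complex_eq_iff cos_add cos_diff sin_add sin_diff field_simps)
  have C: "(\<integral>\<omega>. (w \<omega> * cos (S a \<omega>)) * indicator (B k) (U k \<omega>) \<partial>P)
      = (\<integral>\<omega>. (w' \<omega> * cos (S' a \<omega>)) * indicator (B k) (V k \<omega>) \<partial>Q)"
  proof (rule weighted_Levy_uniqueness[OF P Q _ _ _ _ _ _ ee])
    show "\<bar>w \<omega> * cos (S a \<omega>)\<bar> \<le> 1" for \<omega> using w01(1)[of \<omega>] by auto
    show "\<bar>w' \<omega> * cos (S' a \<omega>)\<bar> \<le> 1" for \<omega> using w01(2)[of \<omega>] by auto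
    show "(CLINT \<omega>|P. of_real (w \<omega> * cos (S a \<omega>)) * iexp (u * U k \<omega>)) =
      (CLINT \<omega>|Q. of_real (w' \<omega> * cos (S' a \<omega>)) * iexp (u * V k \<omega>))" for u
      unfolding cos2 a12[symmetric]
      using intP[of "a1 u"] intP[of "a2 u"] intQ[of "a1 u"] intQ[of "a2 u"]
      by (simp add: IH)
  qed measurable
  have D: "(\<integral>\<omega>. (w \<omega> * sin (S a \<omega>)) * indicator (B k) (U k \<omega>) \<partial>P)
      = (\<integral>\<omega>. (w' \<omega> * sin (S' a \<omega>)) * indicator (B k) (V k \<omega>) \<partial>Q)"
  proof (rule weighted_Levy_uniqueness[OF P Q _ _ _ _ _ _ ee])
    show "\<bar>w \<omega> * sin (S a \<omega>)\<bar> \<le> 1" for \<omega> using w01(1)[of \<omega>] by auto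
    show "\<bar>w' \<omega> * sin (S' a \<omega>)\<bar> \<le> 1" for \<omega> using w01(2)[of \<omega>] by auto
    show "(CLINT \<omega>|P. of_real (w \<omega> * sin (S a \<omega>)) * iexp (u * U k \<omega>)) =
      (CLINT \<omega>|Q. of_real (w' \<omega> * sin (S' a \<omega>)) * iexp (u * V k \<omega>))" for u
      unfolding sin2 a12[symmetric]
      using intP[of "a1 u"] intP[of "a2 u"] intQ[of "a1 u"] intQ[of "a2 u"]
      by (simp add: IH)
  qed measurable
  \<comment> \<open>The real and imaginary parts of the integrand are exactly the integrands of
    \<open>C\<close> and \<open>D\<close>.\<close>
  have split: "of_real (indicator A y * x) * iexp s
      = of_real (x * cos s * indicator A y) + \<i> * of_real (x * sin s * indicator A y)" for A and x y s :: real
    unfolding cis_conv_exp[symmetric] by (simp add: complex_eq_iff)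
  have "integrable P (\<lambda>\<omega>. w \<omega> * cos (S a \<omega>) * indicator (B k) (U k \<omega>))"
       "integrable P (\<lambda>\<omega>. w \<omega> * sin (S a \<omega>) * indicator (B k) (U k \<omega>))"
    by (rule P.integrable_const_bound[of _ 1];
        auto simp: abs_mult indicator_def intro!: mult_le_one w1)+
  moreover have "integrable Q (\<lambda>\<omega>. w' \<omega> * cos (S' a \<omega>) * indicator (B k) (V k \<omega>))"
       "integrable Q (\<lambda>\<omega>. w' \<omega> * sin (S' a \<omega>) * indicator (B k) (V k \<omega>))"
    by (rule Q.integrable_const_bound[of _ 1];
        auto simp: abs_mult indicator_def intro!: mult_le_one w1)+
  ultimately have "(CLINT \<omega>|P. of_real (indicator (B k) (U k \<omega>) * w \<omega>) * iexp (S a \<omega>))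
      = (CLINT \<omega>|Q. of_real (indicator (B k) (V k \<omega>) * w' \<omega>) * iexp (S' a \<omega>))"
    unfolding split
    by (subst (1 2) Bochner_Integration.integral_add) (auto simp: C D simp del: of_real_mult)
  then show ?case
    using insert.hyps by (simp add: w_def w'_def S_def S'_def)
qed

text \<open>Taking \<open>K\<close> = \<open>J\<close> and the zero frequency in
  \<open>char_cylinder_eq\<close> leaves only indicators, so both laws agree on measurable boxes.
  Boxes are stable under intersection and generate the product sigma-algebra.\<close>

theorem Cramer_Wold:
  fixes U :: "'i \<Rightarrow> 'a \<Rightarrow> real" and V :: "'i \<Rightarrow> 'b \<Rightarrow> real"
  assumes P: "prob_space P" and Q: "prob_space Q" and J: "finite J"
    and U [measurable]: "\<And>i. i \<in> J \<Longrightarrow> U i \<in> borel_measurable P"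
    and V [measurable]: "\<And>i. i \<in> J \<Longrightarrow> V i \<in> borel_measurable Q"
    and eq: "\<And>a. (CLINT \<omega>|P. iexp (\<Sum>i\<in>J. a i * U i \<omega>)) = (CLINT \<omega>|Q. iexp (\<Sum>i\<in>J. a i * V i \<omega>))"
  shows "distr P (PiM J (\<lambda>_. borel)) (\<lambda>\<omega>. \<lambda>i\<in>J. U i \<omega>) = distr Q (PiM J (\<lambda>_. borel)) (\<lambda>\<omega>. \<lambda>i\<in>J. V i \<omega>)"
proof (rule measure_eqI_PiM_finite[OF J])
  interpret P: prob_space P by fact
  interpret Q: prob_space Q by fact
  \<comment> \<open>The whole space is itself a box of finite measure, so a constant sequence serves
    as the exhausting one.\<close>
  show "range (\<lambda>_::nat. space (PiM J (\<lambda>_. borel))) \<subseteq> prod_algebra J (\<lambda>_. borel :: real measure)"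
    using prod_algebraI_finite[OF J, of "\<lambda>_. UNIV" "\<lambda>_. borel"] by (simp add: space_PiM)
  fix A :: "'i \<Rightarrow> real set" assume A [measurable]: "\<And>i. i \<in> J \<Longrightarrow> A i \<in> sets borel"
  have *: "indicator (Pi\<^sub>E J A) (\<lambda>i\<in>J. f i) = (\<Prod>i\<in>J. indicator (A i) (f i) :: real)" for f
    using J by (auto simp: indicator_def PiE_iff)
  have "measure (distr P (PiM J (\<lambda>_. borel)) (\<lambda>\<omega>. \<lambda>i\<in>J. U i \<omega>)) (Pi\<^sub>E J A)
      = (\<integral>\<omega>. (\<Prod>i\<in>J. indicator (A i) (U i \<omega>)) \<partial>P)"
    unfolding *[symmetric] using J
    by (subst integral_distr[symmetric, where N = "PiM J (\<lambda>_. borel)"])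
      (auto intro!: borel_measurable_indicator sets_PiM_I_finite simp: sets_PiM_I_finite)
  moreover have "measure (distr Q (PiM J (\<lambda>_. borel)) (\<lambda>\<omega>. \<lambda>i\<in>J. V i \<omega>)) (Pi\<^sub>E J A)
      = (\<integral>\<omega>. (\<Prod>i\<in>J. indicator (A i) (V i \<omega>)) \<partial>Q)"
    unfolding *[symmetric] using J
    by (subst integral_distr[symmetric, where N = "PiM J (\<lambda>_. borel)"])
      (auto intro!: borel_measurable_indicator sets_PiM_I_finite simp: sets_PiM_I_finite)
  moreover have "(\<integral>\<omega>. (\<Prod>i\<in>J. indicator (A i) (U i \<omega>)) \<partial>P) = (\<integral>\<omega>. (\<Prod>i\<in>J. indicator (A i) (V i \<omega>) :: real) \<partial>Q)"
    using char_cylinder_eq[OF P Q J U V eq A subset_refl, where a = "\<lambda>_. 0"]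
    by (simp del: of_real_prod)
  moreover have "prob_space (distr P (PiM J (\<lambda>_. borel)) (\<lambda>\<omega>. \<lambda>i\<in>J. U i \<omega>))"
     "prob_space (distr Q (PiM J (\<lambda>_. borel)) (\<lambda>\<omega>. \<lambda>i\<in>J. V i \<omega>))"
    by (auto intro!: P.prob_space_distr Q.prob_space_distr)
  ultimately show "emeasure (distr P (PiM J (\<lambda>_. borel)) (\<lambda>\<omega>. \<lambda>i\<in>J. U i \<omega>)) (Pi\<^sub>E J A)
    = emeasure (distr Q (PiM J (\<lambda>_. borel)) (\<lambda>\<omega>. \<lambda>i\<in>J. V i \<omega>)) (Pi\<^sub>E J A)"
    by (simp add: finite_measure.emeasure_eq_measure prob_space.finite_measure)
next
  interpret P: prob_space P by fact
  show "emeasure (distr P (PiM J (\<lambda>_. borel)) (\<lambda>\<omega>. \<lambda>i\<in>J. U i \<omega>)) (space (PiM J (\<lambda>_. borel))) \<noteq> \<infinity>"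
    using P.prob_space_distr[of "\<lambda>\<omega>. \<lambda>i\<in>J. U i \<omega>" "PiM J (\<lambda>_. borel)"]
    by (auto dest!: prob_space.emeasure_space_1)
qed auto

section \<open>The Gaussian semigroup\<close>

text \<open>The bound ranges over all functions, not only those in the space of
  \<open>PiM J\<close>, so it forces \<open>f\<close> to ignore coordinates outside
  \<open>J\<close>. It also gives linear growth, hence integrability against Gaussian vectors, and
  it is preserved by \<open>heat\<close>.\<close>

definition coord_lipschitz :: "'i set \<Rightarrow> (('i \<Rightarrow> real) \<Rightarrow> real) \<Rightarrow> bool" where
  "coord_lipschitz J f \<longleftrightarrow> f \<in> borel_measurable (PiM J (\<lambda>_. borel)) \<and>
     (\<forall>x y. \<bar>f x - f y\<bar> \<le> (\<Sum>i\<in>J. \<bar>x i - y i\<bar>))"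

lemma coord_lipschitzD:
  assumes "coord_lipschitz J f"
  shows "f \<in> borel_measurable (PiM J (\<lambda>_. borel))" and "\<bar>f x - f y\<bar> \<le> (\<Sum>i\<in>J. \<bar>x i - y i\<bar>)"
  using assms by (auto simp: coord_lipschitz_def)

lemma coord_lipschitz_abs:
  assumes "coord_lipschitz J f"
  shows "coord_lipschitz J (\<lambda>x. \<bar>f x\<bar>)"
  unfolding coord_lipschitz_def
  using coord_lipschitzD[OF assms] by (auto intro: order_trans[OF abs_triangle_ineq3])

text \<open>Under the scaling by \<open>sqrt t\<close> covariances are linear in \<open>t\<close>,
  which makes \<open>t\<close> the semigroup parameter. The restriction to \<open>J\<close> puts the
  argument into the space on which \<open>f\<close> is measurable.\<close>

definition heat :: "'a measure \<Rightarrow> 'i set \<Rightarrow> ('i \<Rightarrow> 'a \<Rightarrow> real) \<Rightarrow> real \<Rightarrow> (('i \<Rightarrow> real) \<Rightarrow> real) \<Rightarrow> ('i \<Rightarrow> real) \<Rightarrow> real"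
  where "heat M J X t f x = (\<integral>\<omega>. f (\<lambda>i\<in>J. x i + sqrt t * X i \<omega>) \<partial>M)"

locale gaussian_vector = prob_space M for M :: "'a measure" +
  fixes J :: "'i set" and X :: "'i \<Rightarrow> 'a \<Rightarrow> real"
  assumes finite_index: "finite J"
    and gaussian: "centered_gaussian M (\<lambda>\<omega>. \<Sum>i\<in>J. a i * X i \<omega>)"
begin

lemma gaussian_component: "i \<in> J \<Longrightarrow> centered_gaussian M (X i)"
  using gaussian[of "\<lambda>j. if j = i then 1 else 0"] finite_index
  by (simp add: if_distrib[of "\<lambda>x. x * _"] cong: if_cong)

lemma gaussian_diff: "i \<in> J \<Longrightarrow> j \<in> J \<Longrightarrow> centered_gaussian M (\<lambda>\<omega>. X i \<omega> - X j \<omega>)"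
  using gaussian[of "\<lambda>l. (if l = i then 1 else 0) - (if l = j then 1 else 0)"] finite_index
  by (simp add: if_distrib[of "\<lambda>x. x * _"] left_diff_distrib sum_subtractf cong: if_cong)

lemma component_measurable [measurable]: "i \<in> J \<Longrightarrow> X i \<in> borel_measurable M"
  using gaussian_component by (simp add: centered_gaussian_def)

lemma scaled: "gaussian_vector M J (\<lambda>i \<omega>. c * X i \<omega>)"
proof
  show "centered_gaussian M (\<lambda>\<omega>. \<Sum>i\<in>J. a i * (c * X i \<omega>))" for a
    using gaussian[of "\<lambda>i. a i * c"] by (simp add: mult.assoc)
qed (fact finite_index)

lemma heat_integrable:
  assumes "coord_lipschitz J f"
  shows "integrable M (\<lambda>\<omega>. f (\<lambda>i\<in>J. x i + sqrt t * X i \<omega>))"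
proof (rule Bochner_Integration.integrable_bound)
  note [measurable] = coord_lipschitzD(1)[OF assms]
  show "integrable M (\<lambda>\<omega>. \<bar>f x\<bar> + (\<Sum>i\<in>J. \<bar>sqrt t\<bar> * \<bar>X i \<omega>\<bar>))"
    by (intro Bochner_Integration.integrable_add Bochner_Integration.integrable_sum
        integrable_mult_right integrable_abs integrable_const
        centered_gaussian_integrable[OF prob_space_axioms] gaussian_component)
  show "(\<lambda>\<omega>. f (\<lambda>i\<in>J. x i + sqrt t * X i \<omega>)) \<in> borel_measurable M"
    by measurable
  show "AE \<omega> in M. norm (f (\<lambda>i\<in>J. x i + sqrt t * X i \<omega>)) \<le> norm (\<bar>f x\<bar> + (\<Sum>i\<in>J. \<bar>sqrt t\<bar> * \<bar>X i \<omega>\<bar>))"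
  proof (rule AE_I2)
    fix \<omega>
    have "\<bar>f (\<lambda>i\<in>J. x i + sqrt t * X i \<omega>) - f x\<bar> \<le> (\<Sum>i\<in>J. \<bar>sqrt t\<bar> * \<bar>X i \<omega>\<bar>)"
      using coord_lipschitzD(2)[OF assms, of "\<lambda>i\<in>J. x i + sqrt t * X i \<omega>" x]
      by (simp add: abs_mult)
    moreover have "0 \<le> (\<Sum>i\<in>J. \<bar>sqrt t\<bar> * \<bar>X i \<omega>\<bar>)" by (simp add: sum_nonneg)
    ultimately show "norm (f (\<lambda>i\<in>J. x i + sqrt t * X i \<omega>)) \<le> norm (\<bar>f x\<bar> + (\<Sum>i\<in>J. \<bar>sqrt t\<bar> * \<bar>X i \<omega>\<bar>))"
      unfolding real_norm_def by linarith
  qed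
qed

lemma coord_lipschitz_heat:
  assumes f: "coord_lipschitz J f"
  shows "coord_lipschitz J (heat M J X t f)"
  unfolding coord_lipschitz_def
proof (intro conjI allI)
  note [measurable] = coord_lipschitzD(1)[OF f]
  have [measurable]: "(\<lambda>(x, \<omega>). f (\<lambda>i\<in>J. x i + sqrt t * X i \<omega>)) \<in> borel_measurable (PiM J (\<lambda>_. borel) \<Otimes>\<^sub>M M)"
    by measurable
  show "heat M J X t f \<in> borel_measurable (PiM J (\<lambda>_. borel))"
    unfolding heat_def [abs_def] by measurable
  fix x y
  have "heat M J X t f x - heat M J X t f y
     = (\<integral>\<omega>. f (\<lambda>i\<in>J. x i + sqrt t * X i \<omega>) - f (\<lambda>i\<in>J. y i + sqrt t * X i \<omega>) \<partial>M)"
    unfolding heat_def by (intro Bochner_Integration.integral_diff[symmetric] heat_integrable f)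
  moreover have "\<bar>\<dots>\<bar> \<le> (\<integral>\<omega>. (\<Sum>i\<in>J. \<bar>x i - y i\<bar>) \<partial>M)"
  proof (rule order_trans[OF integral_abs_bound integral_mono])
    show "integrable M (\<lambda>\<omega>. \<bar>f (\<lambda>i\<in>J. x i + sqrt t * X i \<omega>) - f (\<lambda>i\<in>J. y i + sqrt t * X i \<omega>)\<bar>)"
      by (intro integrable_abs Bochner_Integration.integrable_diff heat_integrable f)
    show "\<bar>f (\<lambda>i\<in>J. x i + sqrt t * X i \<omega>) - f (\<lambda>i\<in>J. y i + sqrt t * X i \<omega>)\<bar> \<le> (\<Sum>i\<in>J. \<bar>x i - y i\<bar>)" for \<omega>
      using coord_lipschitzD(2)[OF f, of "\<lambda>i\<in>J. x i + sqrt t * X i \<omega>" "\<lambda>i\<in>J. y i + sqrt t * X i \<omega>"]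
      by simp
  qed simp
  ultimately show "\<bar>heat M J X t f x - heat M J X t f y\<bar> \<le> (\<Sum>i\<in>J. \<bar>x i - y i\<bar>)"
    by (simp add: prob_space)
qed

text \<open>Averaging over a probability space fixes constants, so an additive error
  \<open>c\<close> passes through unamplified. Errors of successive steps therefore just add
  up.\<close>

lemma heat_mono:
  assumes "coord_lipschitz J f" "coord_lipschitz J g" "\<And>y. f y - c \<le> g y"
  shows "heat M J X t f x - c \<le> heat M J X t g x"
proof -
  have "heat M J X t f x - c = (\<integral>\<omega>. f (\<lambda>i\<in>J. x i + sqrt t * X i \<omega>) - c \<partial>M)"
    unfolding heat_def using heat_integrable[OF assms(1)]
    by (subst Bochner_Integration.integral_diff) (auto simp: prob_space)
  also have "\<dots> \<le> heat M J X t g x"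
    unfolding heat_def
    by (intro integral_mono Bochner_Integration.integrable_diff heat_integrable integrable_const assms)
  finally show ?thesis .
qed

text \<open>The two factors of the product space carry independent copies of \<open>X\<close>. By
  \<open>Cramer_Wold\<close> only a single linear form \<open>S\<close> has to be checked; there the
  characteristic functions multiply and the exponents add up to that of
  \<open>sqrt (s + t)\<close>.\<close>

lemma sum_rotation_law:
  assumes s: "s \<ge> 0" and t: "t \<ge> 0"
  shows "distr (M \<Otimes>\<^sub>M M) (PiM J (\<lambda>_. borel)) (\<lambda>z. \<lambda>i\<in>J. sqrt s * X i (fst z) + sqrt t * X i (snd z))
       = distr M (PiM J (\<lambda>_. borel)) (\<lambda>\<omega>. \<lambda>i\<in>J. sqrt (s + t) * X i \<omega>)"
proof (rule Cramer_Wold)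
  interpret MM: pair_prob_space M M ..
  show "prob_space (M \<Otimes>\<^sub>M M)" by (fact MM.P.prob_space_axioms)
  show "prob_space M" by (fact prob_space_axioms)
  show "finite J" by (fact finite_index)
  fix a :: "'i \<Rightarrow> real"
  define S where "S \<omega> = (\<Sum>i\<in>J. a i * X i \<omega>)" for \<omega>
  have S: "centered_gaussian M S" unfolding S_def [abs_def] by (rule gaussian)
  then have [measurable]: "S \<in> borel_measurable M" by (simp add: centered_gaussian_def)
  note char = centered_gaussian_char[OF prob_space_axioms S]
  have "(CLINT z|M \<Otimes>\<^sub>M M. iexp (\<Sum>i\<in>J. a i * (sqrt s * X i (fst z) + sqrt t * X i (snd z))))
      = (CLINT z|M \<Otimes>\<^sub>M M. iexp (sqrt s * S (fst z)) * iexp (sqrt t * S (snd z)))"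
    by (simp add: S_def exp_add[symmetric] sum_distrib_left sum.distrib algebra_simps)
  also have "\<dots> = (CLINT \<omega>|M. CLINT \<omega>'|M. iexp (sqrt s * S \<omega>) * iexp (sqrt t * S \<omega>'))"
    by (subst MM.integral_fst'[symmetric])
      (auto intro!: MM.P.integrable_const_bound[of _ 1] simp: norm_mult)
  also have "\<dots> = (CLINT \<omega>|M. iexp (sqrt s * S \<omega>)) * (CLINT \<omega>'|M. iexp (sqrt t * S \<omega>'))"
    by simp
  also have "\<dots> = (CLINT \<omega>|M. iexp (sqrt (s + t) * S \<omega>))"
    unfolding char using s t
    by (simp add: exp_add[symmetric] of_real_mult[symmetric] algebra_simps add_divide_distrib
       diff_divide_distrib del: of_real_mult of_real_exp)
  also have "\<dots> = (CLINT \<omega>|M. iexp (\<Sum>i\<in>J. a i * (sqrt (s + t) * X i \<omega>)))"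
    by (simp add: S_def sum_distrib_left algebra_simps)
  finally show "(CLINT z|M \<Otimes>\<^sub>M M. iexp (\<Sum>i\<in>J. a i * (sqrt s * X i (fst z) + sqrt t * X i (snd z))))
     = (CLINT \<omega>|M. iexp (\<Sum>i\<in>J. a i * (sqrt (s + t) * X i \<omega>)))" .
qed measurable

lemma heat_heat:
  assumes f: "coord_lipschitz J f" and s: "s \<ge> 0" and t: "t \<ge> 0"
  shows "heat M J X s (heat M J X t f) x = heat M J X (s + t) f x"
proof -
  interpret MM: pair_prob_space M M ..
  note [measurable] = coord_lipschitzD(1)[OF f]
  let ?U = "\<lambda>z. \<lambda>i\<in>J. sqrt s * X i (fst z) + sqrt t * X i (snd z)"
  \<comment> \<open>Absorbing the shift by \<open>x\<close> into \<open>g\<close> makes both sides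
    integrals of one function against the two laws of \<open>sum_rotation_law\<close>.\<close>
  define g where "g y = f (\<lambda>i\<in>J. x i + y i)" for y
  have [measurable]: "g \<in> borel_measurable (PiM J (\<lambda>_. borel))"
    unfolding g_def [abs_def] by measurable
  have [measurable]: "?U \<in> (M \<Otimes>\<^sub>M M) \<rightarrow>\<^sub>M PiM J (\<lambda>_. borel)"
     "(\<lambda>\<omega>. \<lambda>i\<in>J. sqrt (s + t) * X i \<omega>) \<in> M \<rightarrow>\<^sub>M PiM J (\<lambda>_. borel)"
    by measurable
  have eq: "g (\<lambda>i\<in>J. v i) = f (\<lambda>i\<in>J. x i + v i)" for v
    by (simp add: g_def cong: restrict_cong)
  \<comment> \<open>Integrability is known for a single copy of \<open>X\<close>; equality of laws
    carries it to the product space, where Fubini's theorem requires it.\<close>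
  have "integrable (distr M (PiM J (\<lambda>_. borel)) (\<lambda>\<omega>. \<lambda>i\<in>J. sqrt (s + t) * X i \<omega>)) g"
    using heat_integrable[OF f, of x "s + t"] by (subst integrable_distr_eq) (auto simp: eq)
  then have i: "integrable (M \<Otimes>\<^sub>M M) (\<lambda>z. g (?U z))"
    unfolding sum_rotation_law[OF s t, symmetric] by (subst (asm) integrable_distr_eq) auto
  have "heat M J X s (heat M J X t f) x = (\<integral>\<omega>. \<integral>\<omega>'. g (?U (\<omega>, \<omega>')) \<partial>M \<partial>M)"
    by (simp add: heat_def eq add.assoc cong: restrict_cong)
  also have "\<dots> = (\<integral>z. g (?U z) \<partial>(M \<Otimes>\<^sub>M M))"
    using MM.integral_fst'[OF i] by simp
  also have "\<dots> = integral\<^sup>L (distr (M \<Otimes>\<^sub>M M) (PiM J (\<lambda>_. borel)) ?U) g"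
    by (simp add: integral_distr)
  also have "\<dots> = (\<integral>\<omega>. g (\<lambda>i\<in>J. sqrt (s + t) * X i \<omega>) \<partial>M)"
    unfolding sum_rotation_law[OF s t] by (simp add: integral_distr)
  finally show ?thesis by (simp add: heat_def eq)
qed

end

text \<open>The two vectors may live on different spaces. Both orders of averaging are iterated
  integrals of one function on the product space.\<close>

lemma heat_commute:
  assumes "gaussian_vector M J X" "gaussian_vector N J Y" and f: "coord_lipschitz J f"
  shows "heat M J X s (heat N J Y t f) x = heat N J Y t (heat M J X s f) x"
proof -
  interpret M: gaussian_vector M J X by fact
  interpret N: gaussian_vector N J Y by fact
  interpret MN: pair_prob_space M N ..
  note [measurable] = coord_lipschitzD(1)[OF f]
  let ?F = "\<lambda>\<omega> \<omega>'. f (\<lambda>i\<in>J. x i + sqrt s * X i \<omega> + sqrt t * Y i \<omega>')"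
  have i: "integrable (M \<Otimes>\<^sub>M N) (\<lambda>(\<omega>, \<omega>'). ?F \<omega> \<omega>')"
  proof (rule MN.Fubini_integrable)
    \<comment> \<open>The inner integral is \<open>heat\<close> of the absolute value of
      \<open>f\<close>, which is again coordinate-Lipschitz and so integrable along
      \<open>X\<close>.\<close>
    show "integrable M (\<lambda>\<omega>. \<integral>\<omega>'. norm (case (\<omega>, \<omega>') of (\<omega>, \<omega>') \<Rightarrow> ?F \<omega> \<omega>') \<partial>N)"
      using M.heat_integrable[OF N.coord_lipschitz_heat[OF coord_lipschitz_abs[OF f]], where x = x and t = s]
      by (simp add: heat_def cong: restrict_cong)
    show "AE \<omega> in M. integrable N (\<lambda>\<omega>'. case (\<omega>, \<omega>') of (\<omega>, \<omega>') \<Rightarrow> ?F \<omega> \<omega>')"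
      using N.heat_integrable[OF f] by simp
  qed measurable
  have "heat M J X s (heat N J Y t f) x = (\<integral>\<omega>. \<integral>\<omega>'. ?F \<omega> \<omega>' \<partial>N \<partial>M)"
    by (simp add: heat_def cong: restrict_cong)
  also have "\<dots> = (\<integral>\<omega>'. \<integral>\<omega>. ?F \<omega> \<omega>' \<partial>M \<partial>N)"
    using MN.Fubini_integral[OF i] by simp
  also have "\<dots> = heat N J Y t (heat M J X s f) x"
    by (simp add: heat_def algebra_simps cong: restrict_cong)
  finally show ?thesis .
qed

section \<open>The log-sum-exp function\<close>

definition lse :: "'i set \<Rightarrow> ('i \<Rightarrow> real) \<Rightarrow> real" where
  "lse J x = ln (\<Sum>i\<in>J. exp (x i))"

definition gibbs :: "'i set \<Rightarrow> ('i \<Rightarrow> real) \<Rightarrow> 'i \<Rightarrow> real" where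
  "gibbs J x i = exp (x i) / (\<Sum>j\<in>J. exp (x j))"

lemma gibbs_nonneg: "gibbs J x i \<ge> 0"
  by (simp add: gibbs_def sum_nonneg)

lemma sum_gibbs: "finite J \<Longrightarrow> J \<noteq> {} \<Longrightarrow> (\<Sum>i\<in>J. gibbs J x i) = 1"
  using sum_pos[of J "\<lambda>j. exp (x j)"]
  by (simp add: gibbs_def sum_divide_distrib[symmetric])

lemma abs_weighted_average_le:
  fixes d :: "'i \<Rightarrow> real"
  assumes "finite J" "J \<noteq> {}" "\<And>i. i \<in> J \<Longrightarrow> \<bar>d i\<bar> \<le> D"
  shows "\<bar>\<Sum>i\<in>J. gibbs J x i * d i\<bar> \<le> D"
proof -
  have "\<bar>\<Sum>i\<in>J. gibbs J x i * d i\<bar> \<le> (\<Sum>i\<in>J. gibbs J x i * D)"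
    using assms(3) by (intro sum_abs[THEN order_trans] sum_mono)
      (auto simp: abs_mult gibbs_nonneg intro!: mult_left_mono)
  also have "\<dots> = D"
    using sum_gibbs[OF assms(1,2)] by (simp flip: sum_distrib_right)
  finally show ?thesis .
qed

text \<open>A variance is half the mean squared difference of two independent draws. In this form
  only differences \<open>d i - d j\<close> occur, and those are what the hypothesis on increments
  controls.\<close>

lemma gibbs_variance:
  fixes d :: "'i \<Rightarrow> real"
  assumes "finite J" "J \<noteq> {}"
  shows "(\<Sum>i\<in>J. gibbs J x i * (d i)\<^sup>2) - (\<Sum>i\<in>J. gibbs J x i * d i)\<^sup>2
       = (\<Sum>i\<in>J. \<Sum>j\<in>J. gibbs J x i * gibbs J x j * (d i - d j)\<^sup>2) / 2"
proof -
  let ?p = "gibbs J x" 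
  have "(\<Sum>i\<in>J. \<Sum>j\<in>J. ?p i * ?p j * (d i - d j)\<^sup>2)
      = (\<Sum>i\<in>J. \<Sum>j\<in>J. (?p i * (d i)\<^sup>2) * ?p j + ?p i * (?p j * (d j)\<^sup>2) - 2 * ((?p i * d i) * (?p j * d j)))"
    by (intro sum.cong refl) (simp add: power2_eq_square algebra_simps)
  also have "\<dots> = 2 * (\<Sum>i\<in>J. ?p i * (d i)\<^sup>2) - 2 * (\<Sum>i\<in>J. ?p i * d i)\<^sup>2"
    using sum_gibbs[OF assms, of x]
    by (simp add: sum.distrib sum_subtractf sum_distrib_left[symmetric] sum_distrib_right[symmetric]
        power2_eq_square)
  finally show ?thesis by simp
qed

text \<open>Second-order Taylor expansion along the line through \<open>x\<close> in direction
  \<open>d\<close>. The derivatives are cumulants of \<open>d\<close> under Gibbs weights, so they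
  are bounded in terms of \<open>D\<close> alone and the remainder is uniform in
  \<open>x\<close>.\<close>

lemma lse_taylor:
  fixes x d :: "'i \<Rightarrow> real"
  assumes J: "finite J" "J \<noteq> {}" and h: "h > 0" and D: "\<And>i. i \<in> J \<Longrightarrow> \<bar>d i\<bar> \<le> D"
  shows "\<bar>lse J (\<lambda>i. x i + h * d i) - lse J x - h * (\<Sum>i\<in>J. gibbs J x i * d i)
           - h\<^sup>2 / 4 * (\<Sum>i\<in>J. \<Sum>j\<in>J. gibbs J x i * gibbs J x j * (d i - d j)\<^sup>2)\<bar> \<le> h ^ 3 * D ^ 3"
proof -
  \<comment> \<open>\<open>a k t\<close> is the \<open>k\<close>-th moment of \<open>d\<close> under the Gibbs weights at \<open>x + t d\<close>.\<close>
  define N where "N k t = (\<Sum>i\<in>J. (d i) ^ k * exp (x i + t * d i))" for k t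
  define a where "a k t = N k t / N 0 t" for k t
  have N0: "N 0 t > 0" for t
    unfolding N_def using J by (auto intro!: sum_pos)
  have dN: "(N k has_real_derivative N (Suc k) t) (at t)" for k t
    unfolding N_def [abs_def] by (auto intro!: derivative_eq_intros sum.cong simp: mult_ac)
  have da: "(a k has_real_derivative (a (Suc k) t - a k t * a 1 t)) (at t)" for k t
  proof -
    have "(a k has_real_derivative (N (Suc k) t * N 0 t - N k t * N (Suc 0) t) / (N 0 t * N 0 t)) (at t)"
      unfolding a_def [abs_def] using N0[of t] by (intro DERIV_divide dN) auto
    also have "(N (Suc k) t * N 0 t - N k t * N (Suc 0) t) / (N 0 t * N 0 t) = a (Suc k) t - a k t * a 1 t"
      using N0[of t] by (simp add: a_def field_simps)
    finally show ?thesis .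
  qed
  have a_gibbs: "a k t = (\<Sum>i\<in>J. gibbs J (\<lambda>i. x i + t * d i) i * (d i) ^ k)" for k t
    by (simp add: a_def N_def gibbs_def sum_divide_distrib mult_ac)
  have a_le: "\<bar>a k t\<bar> \<le> D ^ k" for k t
    unfolding a_gibbs using D
    by (intro abs_weighted_average_le J) (auto simp: power_abs intro!: power_mono)
  have D0: "D \<ge> 0" using J D by (metis abs_ge_zero ex_in_conv order_trans)
  define f where "f t = lse J (\<lambda>i. x i + t * d i)" for t
  \<comment> \<open>For \<open>m\<close> = 1, 2, 3 these are the cumulants of \<open>d\<close> under
    the weights at time \<open>t\<close>, in terms of its moments.\<close>
  define diff where "diff = (\<lambda>(m::nat) t. if m = 0 then f t else if m = 1 then a 1 t
      else if m = 2 then a 2 t - (a 1 t)\<^sup>2 else a 3 t - 3 * a 1 t * a 2 t + 2 * (a 1 t) ^ 3 )"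
  have "\<exists>t>0. t < h \<and> f h = (\<Sum>m<3. diff m 0 / fact m * h ^ m) + diff 3 t / fact 3 * h ^ 3"
  proof (rule Maclaurin[OF h])
    show "diff 0 = f" by (simp add: diff_def)
    have f: "(f has_real_derivative a 1 t) (at t)" for t
    proof -
      have "f = (\<lambda>t. ln (N 0 t))" by (simp add: f_def lse_def N_def fun_eq_iff)
      then show ?thesis
        using DERIV_chain2[OF DERIV_ln[OF N0[of t]] dN[of 0 t]]
        by (simp add: a_def divide_inverse mult_ac)
    qed
    show "\<forall>m t. m < 3 \<and> 0 \<le> t \<and> t \<le> h \<longrightarrow> (diff m has_real_derivative diff (Suc m) t) (at t)"
    proof (intro allI impI)
      fix m :: nat and t assume "m < 3 \<and> 0 \<le> t \<and> t \<le> h"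
      then consider "m = 0" | "m = 1" | "m = 2" by linarith
      then show "(diff m has_real_derivative diff (Suc m) t) (at t)"
      proof cases
        case 1 then show ?thesis using f[of t] by (simp add: diff_def)
      next
        case 2 then show ?thesis using da[of 1 t] 
          by (simp add: diff_def power2_eq_square numeral_2_eq_2)
      next
        case 3
        have "((\<lambda>t. a 2 t - (a 1 t)\<^sup>2) has_real_derivative
            (a 3 t - a 2 t * a 1 t) - 2 * a 1 t * (a 2 t - a 1 t * a 1 t)) (at t)"
          by (rule derivative_eq_intros da[of 2 t] da[of 1 t] refl | simp add: numeral_eq_Suc)+
        then show ?thesis using 3
          by (simp add: diff_def power3_eq_cube algebra_simps)
      qed
    qed
  qed simp
  then obtain t where eq: "f h = (\<Sum>m<3. diff m 0 / fact m * h ^ m) + diff 3 t / fact 3 * h ^ 3"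
    by blast
  have a0: "a k 0 = (\<Sum>i\<in>J. gibbs J x i * (d i) ^ k)" for k
    by (simp add: a_gibbs)
  let ?Q = "\<Sum>i\<in>J. \<Sum>j\<in>J. gibbs J x i * gibbs J x j * (d i - d j)\<^sup>2"
  have "f h - lse J x - h * a 1 0 - h\<^sup>2 / 2 * (a 2 0 - (a 1 0)\<^sup>2) = diff 3 t / 6 * h ^ 3"
  proof -
    have "(\<Sum>m<3. diff m 0 / fact m * h ^ m) = lse J x + h * a 1 0 + h\<^sup>2 / 2 * (a 2 0 - (a 1 0)\<^sup>2)"
      by (simp add: diff_def f_def numeral_3_eq_3 lessThan_Suc power2_eq_square)
    then show ?thesis
      unfolding eq by (simp add: fact_numeral)
  qed
  moreover have "h\<^sup>2 / 2 * (a 2 0 - (a 1 0)\<^sup>2) = h\<^sup>2 / 4 * ?Q"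
    using gibbs_variance[OF J, of x d] by (simp add: a0)
  ultimately have "f h - lse J x - h * a 1 0 - h\<^sup>2 / 4 * ?Q = diff 3 t / 6 * h ^ 3"
    by argo
  \<comment> \<open>The coefficients of the third cumulant sum to 1 + 3 + 2 = 6 in absolute value,
    which cancels the 3! of the remainder.\<close>
  moreover have "\<bar>diff 3 t\<bar> \<le> 6 * D ^ 3"
  proof -
    have "\<bar>a 1 t * a 2 t\<bar> \<le> D * D\<^sup>2"
      unfolding abs_mult using a_le[of 1 t] a_le[of 2 t] D0 by (intro mult_mono) auto
    moreover have "\<bar>a 1 t ^ 3\<bar> \<le> D ^ 3"
      unfolding power_abs using a_le[of 1 t] by (intro power_mono) auto
    ultimately show ?thesis
      using a_le[of 3 t] by (simp add: diff_def eval_nat_numeral algebra_simps abs_le_iff)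
  qed
  then have "\<bar>diff 3 t / 6 * h ^ 3\<bar> \<le> h ^ 3 * D ^ 3"
    using h by (simp add: abs_mult field_simps)
  ultimately show ?thesis
    by (simp add: f_def a0)
qed

lemma lse_lipschitz:
  fixes x y :: "'i \<Rightarrow> real"
  assumes J: "finite J" "J \<noteq> {}" 
  shows "\<bar>lse J x - lse J y\<bar> \<le> (\<Sum>i\<in>J. \<bar>x i - y i\<bar>)"
proof -
  have *: "lse J x \<le> lse J y + (\<Sum>i\<in>J. \<bar>x i - y i\<bar>)" for x y :: "'i \<Rightarrow> real"
  proof -
    let ?S = "\<Sum>i\<in>J. \<bar>x i - y i\<bar>"
    have "x i \<le> y i + ?S" if "i \<in> J" for i
      using member_le_sum[OF that, of "\<lambda>i. \<bar>x i - y i\<bar>"] J by auto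
    then have "(\<Sum>i\<in>J. exp (x i)) \<le> (\<Sum>i\<in>J. exp (y i)) * exp ?S"
      by (auto simp: sum_distrib_right exp_add[symmetric] intro!: sum_mono)
    moreover have "0 < (\<Sum>i\<in>J. exp (x i))" "0 < (\<Sum>i\<in>J. exp (y i))"
      using J by (auto intro!: sum_pos)
    ultimately have "lse J x \<le> ln ((\<Sum>i\<in>J. exp (y i)) * exp ?S)"
      by (simp add: lse_def)
    also have "\<dots> = lse J y + ?S"
      using \<open>0 < (\<Sum>i\<in>J. exp (y i))\<close> by (simp add: lse_def ln_mult)
    finally show ?thesis .
  qed
  show ?thesis
    using *[of x y] *[of y x] by (simp add: abs_le_iff abs_minus_commute)
qed

text \<open>The gap \<open>ln (card J)\<close> does not depend on \<open>x\<close>, so it becomes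
  negligible once \<open>x\<close> is multiplied by a large factor.\<close>

lemma Max_le_lse:
  assumes J: "finite J" "J \<noteq> {}" 
  shows "Max (x ` J) \<le> lse J x" and "lse J x \<le> Max (x ` J) + ln (card J)"
proof -
  have "x i \<le> lse J x" if "i \<in> J" for i
  proof -
    have "exp (x i) \<le> (\<Sum>i\<in>J. exp (x i))"
      using J that by (intro member_le_sum) auto
    then have "ln (exp (x i)) \<le> lse J x"
      unfolding lse_def by (rule ln_mono) auto
    then show ?thesis by simp
  qed
  then show "Max (x ` J) \<le> lse J x" using J by auto
  have "(\<Sum>i\<in>J. exp (x i)) \<le> (\<Sum>i\<in>J. exp (Max (x ` J)))"
    using J by (intro sum_mono) auto
  then have "(\<Sum>i\<in>J. exp (x i)) \<le> card J * exp (Max (x ` J))" by simp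
  moreover have "0 < (\<Sum>i\<in>J. exp (x i))" using J by (auto intro!: sum_pos)
  ultimately have "lse J x \<le> ln (card J * exp (Max (x ` J)))"
    by (simp add: lse_def)
  also have "\<dots> = Max (x ` J) + ln (card J)"
    using J by (subst ln_mult) (auto simp: card_gt_0_iff)
  finally show "lse J x \<le> Max (x ` J) + ln (card J)" .
qed

section \<open>Comparison for finite index sets\<close>

lemma lse_restrict [simp]: "lse J (restrict x J) = lse J x"
  by (simp add: lse_def)

lemma coord_lipschitz_lse:
  assumes "finite J" "J \<noteq> {}"
  shows "coord_lipschitz J (lse J)"
  unfolding coord_lipschitz_def
proof (intro conjI allI lse_lipschitz assms)
  show "lse J \<in> borel_measurable (PiM J (\<lambda>_. borel))"
    unfolding lse_def [abs_def] by measurable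
qed

text \<open>\<open>lse_taylor\<close> is applied pointwise in direction \<open>X\<close> with step
  \<open>sqrt h\<close>. The first-order term is a fixed linear combination of the coordinates and
  has mean zero; the second-order term is of size \<open>h\<close>.\<close>

lemma (in gaussian_vector) heat_lse_expansion:
  assumes J: "J \<noteq> {}" and h: "h > 0"
  shows "\<bar>heat M J X h (lse J) x - lse J x
     - h / 4 * (\<Sum>i\<in>J. \<Sum>j\<in>J. gibbs J x i * gibbs J x j * expectation (\<lambda>\<omega>. (X i \<omega> - X j \<omega>)\<^sup>2))\<bar>
     \<le> h * sqrt h * expectation (\<lambda>\<omega>. \<Sum>i\<in>J. \<bar>X i \<omega>\<bar> ^ 3)"
proof -
  let ?g = "\<lambda>\<omega>. lse J (\<lambda>i. x i + sqrt h * X i \<omega>)"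
  let ?L = "\<lambda>\<omega>. \<Sum>i\<in>J. gibbs J x i * X i \<omega>"
  let ?Q = "\<lambda>\<omega>. \<Sum>i\<in>J. \<Sum>j\<in>J. gibbs J x i * gibbs J x j * (X i \<omega> - X j \<omega>)\<^sup>2"
  let ?R = "\<lambda>\<omega>. \<Sum>i\<in>J. \<bar>X i \<omega>\<bar> ^ 3"
  have ig: "integrable M ?g"
    using heat_integrable[OF coord_lipschitz_lse[OF finite_index J], of x h] by simp
  have iL: "integrable M ?L"
    by (rule centered_gaussian_integrable[OF prob_space_axioms gaussian])
  have iq: "integrable M (\<lambda>\<omega>. (X i \<omega> - X j \<omega>)\<^sup>2)" if "i \<in> J" "j \<in> J" for i j
    using centered_gaussian_integrable_power[OF prob_space_axioms gaussian_diff[OF that], of 2] by simp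
  have iQ: "integrable M ?Q"
    by (intro Bochner_Integration.integrable_sum integrable_mult_right iq)
  have iR: "integrable M ?R"
    by (intro Bochner_Integration.integrable_sum centered_gaussian_integrable_power[OF prob_space_axioms]
        gaussian_component)
  have EL: "expectation ?L = 0"
    by (rule centered_gaussian_expectation[OF prob_space_axioms gaussian])
  have EQ: "expectation ?Q = (\<Sum>i\<in>J. \<Sum>j\<in>J. gibbs J x i * gibbs J x j * expectation (\<lambda>\<omega>. (X i \<omega> - X j \<omega>)\<^sup>2))"
    using iq by (subst Bochner_Integration.integral_sum, force)
      (intro sum.cong refl, subst Bochner_Integration.integral_sum, auto)
  have "\<bar>?g \<omega> - lse J x - sqrt h * ?L \<omega> - h / 4 * ?Q \<omega>\<bar> \<le> h * sqrt h * ?R \<omega>" for \<omega>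
  proof -
    \<comment> \<open>The largest coordinate bounds the direction. Its cube is one of the summands
      of \<open>?R\<close>, hence dominated by an integrable variable not depending on
      \<open>x\<close>.\<close>
    define D where "D = Max ((\<lambda>i. \<bar>X i \<omega>\<bar>) ` J)"
    have "D \<in> (\<lambda>i. \<bar>X i \<omega>\<bar>) ` J" unfolding D_def using finite_index J by (intro Max_in) auto
    then obtain k where k: "k \<in> J" "D = \<bar>X k \<omega>\<bar>" by blast
    have "\<bar>?g \<omega> - lse J x - sqrt h * ?L \<omega> - (sqrt h)\<^sup>2 / 4 * ?Q \<omega>\<bar> \<le> (sqrt h) ^ 3 * D ^ 3"
      using h finite_index by (intro lse_taylor finite_index J) (auto simp: D_def)
    moreover have "D ^ 3 \<le> ?R \<omega>"
      unfolding k(2) using member_le_sum[OF k(1), of "\<lambda>i. \<bar>X i \<omega>\<bar> ^ 3"] finite_index by simp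
    then have "(sqrt h) ^ 3 * D ^ 3 \<le> h * sqrt h * ?R \<omega>"
      using h by (simp add: power3_eq_cube mult_left_mono)
    ultimately show ?thesis using h by simp
  qed
  then have "expectation (\<lambda>\<omega>. \<bar>?g \<omega> - lse J x - sqrt h * ?L \<omega> - h / 4 * ?Q \<omega>\<bar>) \<le> expectation (\<lambda>\<omega>. h * sqrt h * ?R \<omega>)"
    by (intro integral_mono integrable_abs Bochner_Integration.integrable_diff ig
        integrable_mult_right iL iQ iR integrable_const)
  then have "\<bar>expectation (\<lambda>\<omega>. ?g \<omega> - lse J x - sqrt h * ?L \<omega> - h / 4 * ?Q \<omega>)\<bar> \<le> h * sqrt h * expectation ?R"
    by (intro order_trans[OF integral_abs_bound]) simp
  moreover have "expectation (\<lambda>\<omega>. ?g \<omega> - lse J x - sqrt h * ?L \<omega> - h / 4 * ?Q \<omega>)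
      = expectation ?g - lse J x - sqrt h * expectation ?L - h / 4 * expectation ?Q"
    using ig iL iQ by (simp add: prob_space del: integrable_mult_right_iff)
  moreover have "heat M J X h (lse J) x = expectation ?g"
    by (simp add: heat_def)
  ultimately show ?thesis
    using EL EQ by simp
qed

section \<open>Comparison of log-sum-exp over many small steps\<close>

locale gaussian_comparison = M: gaussian_vector M J X + N: gaussian_vector N J Y
  for M :: "'a measure" and N :: "'b measure" and J :: "'i set" and X Y +
  assumes J_nonempty: "J \<noteq> {}"
    and increments_le: "i \<in> J \<Longrightarrow> j \<in> J \<Longrightarrow>
      M.expectation (\<lambda>\<omega>. (X i \<omega> - X j \<omega>)\<^sup>2) \<le> N.expectation (\<lambda>\<omega>. (Y i \<omega> - Y j \<omega>)\<^sup>2)"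
begin

definition third_moments :: real where
  "third_moments = M.expectation (\<lambda>\<omega>. \<Sum>i\<in>J. \<bar>X i \<omega>\<bar> ^ 3) + N.expectation (\<lambda>\<omega>. \<Sum>i\<in>J. \<bar>Y i \<omega>\<bar> ^ 3)"

lemma lse_coord_lipschitz: "coord_lipschitz J (lse J)"
  by (rule coord_lipschitz_lse[OF M.finite_index J_nonempty])

text \<open>Gibbs weights are nonnegative, so the hypothesis on increments orders the terms of size
  \<open>h\<close>; the errors of the two expansions add up to the loss.\<close>

lemma heat_lse_step:
  assumes h: "h > 0"
  shows "heat M J X h (lse J) x - h * sqrt h * third_moments \<le> heat N J Y h (lse J) x"
proof -
  have "(\<Sum>i\<in>J. \<Sum>j\<in>J. gibbs J x i * gibbs J x j * M.expectation (\<lambda>\<omega>. (X i \<omega> - X j \<omega>)\<^sup>2))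
      \<le> (\<Sum>i\<in>J. \<Sum>j\<in>J. gibbs J x i * gibbs J x j * N.expectation (\<lambda>\<omega>. (Y i \<omega> - Y j \<omega>)\<^sup>2))"
    by (intro sum_mono mult_left_mono increments_le mult_nonneg_nonneg gibbs_nonneg)
  from mult_left_mono[OF this, of "h / 4"] show ?thesis
    using h M.heat_lse_expansion[OF J_nonempty h, of x] N.heat_lse_expansion[OF J_nonempty h, of x]
    unfolding third_moments_def distrib_left abs_le_iff by linarith
qed

text \<open>The one-step comparison is available only for \<open>lse J\<close> itself. So the
  innermost step of \<open>X\<close> is exchanged for one of \<open>Y\<close>, which is then
  commuted to the outside, and the induction hypothesis treats the remaining steps acting on
  \<open>lse J\<close>.\<close>

lemma heat_lse_iterate:
  assumes h: "h > 0"
  shows "heat M J X (real n * h) (lse J) x - real n * (h * sqrt h * third_moments) \<le> heat N J Y (real n * h) (lse J) x"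
proof (induction n arbitrary: x)
  case 0
  show ?case by (simp add: heat_def M.prob_space N.prob_space)
next
  case (Suc n)
  let ?e = "h * sqrt h * third_moments" and ?A = "heat M J X" and ?B = "heat N J Y" and ?s = "real n * h"
  have s: "?s \<ge> 0" "h \<ge> 0" using h by auto
  have "?A (real (Suc n) * h) (lse J) x = ?A ?s (?A h (lse J)) x"
    using M.heat_heat[OF lse_coord_lipschitz s] by (simp add: algebra_simps)
  also have "\<dots> - ?e \<le> ?A ?s (?B h (lse J)) x"
    by (intro M.heat_mono M.coord_lipschitz_heat N.coord_lipschitz_heat lse_coord_lipschitz heat_lse_step h)
  also have "\<dots> = ?B h (?A ?s (lse J)) x"
    by (rule heat_commute[OF M.gaussian_vector_axioms N.gaussian_vector_axioms lse_coord_lipschitz])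
  also have "\<dots> - real n * ?e \<le> ?B h (?B ?s (lse J)) x"
    by (intro N.heat_mono M.coord_lipschitz_heat N.coord_lipschitz_heat lse_coord_lipschitz Suc.IH)
  also have "\<dots> = ?B (real (Suc n) * h) (lse J) x"
    using N.heat_heat[OF lse_coord_lipschitz s(2,1)] by (simp add: algebra_simps)
  finally show ?case by (simp add: algebra_simps)
qed

lemma expectation_lse_le:
  "M.expectation (\<lambda>\<omega>. lse J (\<lambda>i. x i + X i \<omega>)) \<le> N.expectation (\<lambda>\<omega>. lse J (\<lambda>i. x i + Y i \<omega>))"
proof -
  \<comment> \<open>With h = 1/(n+1), the n+1 steps reach time 1 and their total loss (n+1) h sqrt h
    is sqrt h.\<close>
  have "heat M J X 1 (lse J) x - sqrt (1 / real (Suc n)) * third_moments \<le> heat N J Y 1 (lse J) x" for n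
    using heat_lse_iterate[of "1 / real (Suc n)" "Suc n" x] by simp
  moreover have "(\<lambda>n. heat M J X 1 (lse J) x - sqrt (1 / real (Suc n)) * third_moments)
       \<longlonglongrightarrow> heat M J X 1 (lse J) x - sqrt 0 * third_moments"
    by (intro tendsto_intros LIMSEQ_Suc[OF lim_1_over_n])
  ultimately have "heat M J X 1 (lse J) x - sqrt 0 * third_moments \<le> heat N J Y 1 (lse J) x"
    by (intro LIMSEQ_le_const2) auto
  then show ?thesis by (simp add: heat_def)
qed

end

section \<open>From log-sum-exp to the maximum\<close>

lemma (in gaussian_vector) integrable_Max:
  assumes J: "J \<noteq> {}"
  shows "integrable M (\<lambda>\<omega>. Max ((\<lambda>i. c i + X i \<omega>) ` J))"
proof (rule Bochner_Integration.integrable_bound)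
  show "integrable M (\<lambda>\<omega>. \<Sum>i\<in>J. \<bar>c i + X i \<omega>\<bar>)"
    by (intro Bochner_Integration.integrable_sum integrable_abs Bochner_Integration.integrable_add
        integrable_const centered_gaussian_integrable[OF prob_space_axioms] gaussian_component)
  show "(\<lambda>\<omega>. Max ((\<lambda>i. c i + X i \<omega>) ` J)) \<in> borel_measurable M"
    using finite_index by (intro borel_measurable_Max) measurable
  show "AE \<omega> in M. norm (Max ((\<lambda>i. c i + X i \<omega>) ` J)) \<le> norm (\<Sum>i\<in>J. \<bar>c i + X i \<omega>\<bar>)"
  proof (rule AE_I2)
    fix \<omega>
    have "Max ((\<lambda>i. c i + X i \<omega>) ` J) \<in> (\<lambda>i. c i + X i \<omega>) ` J"
      using finite_index J by (intro Max_in) auto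
    then obtain k where "k \<in> J" "Max ((\<lambda>i. c i + X i \<omega>) ` J) = c k + X k \<omega>" by blast
    then show "norm (Max ((\<lambda>i. c i + X i \<omega>) ` J)) \<le> norm (\<Sum>i\<in>J. \<bar>c i + X i \<omega>\<bar>)"
      using member_le_sum[of k J "\<lambda>i. \<bar>c i + X i \<omega>\<bar>"] finite_index by simp
  qed
qed

text \<open>Multiplying both vectors by \<open>b\<close> scales all squared increments by the square
  of \<open>b\<close>, so the comparison of \<open>lse\<close> applies to the scaled vectors.
  Dividing by \<open>b\<close> shrinks the gap between \<open>lse\<close> and the maximum to
  \<open>ln (card J)\<close> over \<open>b\<close>.\<close>

theorem (in gaussian_comparison) expectation_Max_le:
  "M.expectation (\<lambda>\<omega>. Max ((\<lambda>i. c i + X i \<omega>) ` J)) \<le> N.expectation (\<lambda>\<omega>. Max ((\<lambda>i. c i + Y i \<omega>) ` J))"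
proof -
  let ?l = "ln (real (card J))"
  have Max_scale: "Max ((\<lambda>i. b * c i + b * z i) ` J) = b * Max ((\<lambda>i. c i + z i) ` J)" if "b > 0" for b z
    using mono_Max_commute[of "\<lambda>y. b * y" "(\<lambda>i. c i + z i) ` J"] that M.finite_index J_nonempty
    by (simp add: mono_def image_image distrib_left)
  have *: "M.expectation (\<lambda>\<omega>. Max ((\<lambda>i. c i + X i \<omega>) ` J)) - 1 / real (Suc n) * ?l
       \<le> N.expectation (\<lambda>\<omega>. Max ((\<lambda>i. c i + Y i \<omega>) ` J))" for n
  proof -
    define b where "b = real (Suc n)"
    have b: "b > 0" by (simp add: b_def)
    interpret MB: gaussian_vector M J "\<lambda>i \<omega>. b * X i \<omega>" by (rule M.scaled)
    interpret NB: gaussian_vector N J "\<lambda>i \<omega>. b * Y i \<omega>" by (rule N.scaled)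
    interpret B: gaussian_comparison M N J "\<lambda>i \<omega>. b * X i \<omega>" "\<lambda>i \<omega>. b * Y i \<omega>"
      using increments_le
      by unfold_locales (simp_all add: J_nonempty right_diff_distrib[symmetric] power_mult_distrib mult_left_mono)
    have "b * M.expectation (\<lambda>\<omega>. Max ((\<lambda>i. c i + X i \<omega>) ` J))
        = M.expectation (\<lambda>\<omega>. Max ((\<lambda>i. b * c i + b * X i \<omega>) ` J))"
      by (simp add: Max_scale[OF b])
    also have "\<dots> \<le> M.expectation (\<lambda>\<omega>. lse J (\<lambda>i. b * c i + b * X i \<omega>))"
      using MB.heat_integrable[OF lse_coord_lipschitz, of "\<lambda>i. b * c i" 1]
      by (intro integral_mono MB.integrable_Max J_nonempty Max_le_lse(1) M.finite_index) simp
    also have "\<dots> \<le> N.expectation (\<lambda>\<omega>. lse J (\<lambda>i. b * c i + b * Y i \<omega>))"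
      by (rule B.expectation_lse_le)
    also have "\<dots> \<le> N.expectation (\<lambda>\<omega>. Max ((\<lambda>i. b * c i + b * Y i \<omega>) ` J) + ?l)"
      using NB.heat_integrable[OF lse_coord_lipschitz, of "\<lambda>i. b * c i" 1]
      by (intro integral_mono Bochner_Integration.integrable_add NB.integrable_Max J_nonempty
          Max_le_lse(2) M.finite_index N.integrable_const) simp
    also have "\<dots> = b * N.expectation (\<lambda>\<omega>. Max ((\<lambda>i. c i + Y i \<omega>) ` J)) + ?l"
      using NB.integrable_Max[OF J_nonempty, of "\<lambda>i. b * c i"] 
      by (subst Bochner_Integration.integral_add) (auto simp: Max_scale[OF b] N.prob_space)
    finally show ?thesis unfolding b_def[symmetric] using b by (simp add: field_simps)
  qed
  have "(\<lambda>n. M.expectation (\<lambda>\<omega>. Max ((\<lambda>i. c i + X i \<omega>) ` J)) - 1 / real (Suc n) * ?l)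
      \<longlonglongrightarrow> M.expectation (\<lambda>\<omega>. Max ((\<lambda>i. c i + X i \<omega>) ` J)) - 0 * ?l"
    by (intro tendsto_intros LIMSEQ_Suc[OF lim_1_over_n])
  then have "M.expectation (\<lambda>\<omega>. Max ((\<lambda>i. c i + X i \<omega>) ` J)) - 0 * ?l \<le> N.expectation (\<lambda>\<omega>. Max ((\<lambda>i. c i + Y i \<omega>) ` J))"
    using * by (intro LIMSEQ_le_const2) auto
  then show ?thesis by simp
qed

section \<open>Countable index sets\<close>

text \<open>Turns a difference of two integrals into the integral of a nonnegative function plus a
  constant, the form to which monotone convergence applies even if \<open>W\<close> takes the value
  infinity.\<close>

lemma ereal_expectation_bounded_below:
  assumes "prob_space M" and W [measurable]: "W \<in> borel_measurable M" and m: "\<And>\<omega>. ereal m \<le> W \<omega>"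
  shows "ereal_expectation M W = enn2ereal (\<integral>\<^sup>+\<omega>. e2ennreal (W \<omega> - ereal m) \<partial>M) + ereal m"
proof -
  interpret prob_space M by fact
  define A B G where "A = (\<integral>\<^sup>+\<omega>. e2ennreal (W \<omega>) \<partial>M)" and "B = (\<integral>\<^sup>+\<omega>. e2ennreal (- W \<omega>) \<partial>M)"
    and "G = (\<integral>\<^sup>+\<omega>. e2ennreal (W \<omega> - ereal m) \<partial>M)"
  \<comment> \<open>As \<open>ennreal\<close> sends negative numbers to 0, \<open>ennreal m\<close>
    and \<open>ennreal (- m)\<close> are the positive and negative parts of \<open>m\<close>. The
    identity is arranged with sums only, so that it can be integrated without subtraction in
    \<open>ennreal\<close>.\<close>
  have pt: "e2ennreal (w - ereal m) + e2ennreal (- w) + ennreal m = e2ennreal w + ennreal (- m)"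
    if "ereal m \<le> w" for w
  proof (cases w)
    case (real r)
    then have "r \<ge> m" using that by simp
    then have "ennreal (r - m) + ennreal (- r) + ennreal m = ennreal r + ennreal (- m)"
      by (cases "r \<ge> 0"; cases "m \<ge> 0") (simp_all add: ennreal_neg flip: ennreal_plus)
    then show ?thesis using real by simp
  qed (use that in auto)
  have "G + B + ennreal m = (\<integral>\<^sup>+\<omega>. e2ennreal (W \<omega> - ereal m) + e2ennreal (- W \<omega>) + ennreal m \<partial>M)"
    by (simp add: G_def B_def nn_integral_add emeasure_space_1)
  also have "\<dots> = (\<integral>\<^sup>+\<omega>. e2ennreal (W \<omega>) + ennreal (- m) \<partial>M)"
    by (simp add: pt m)
  also have "\<dots> = A + ennreal (- m)"
    by (simp add: A_def nn_integral_add emeasure_space_1)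
  finally have eq: "enn2ereal (G + B + ennreal m) = enn2ereal (A + ennreal (- m))"
    by simp
  \<comment> \<open>The lower bound on \<open>W\<close> makes the negative part finite, so it can be
    cancelled in \<open>eq\<close>.\<close>
  have "B \<le> (\<integral>\<^sup>+\<omega>. ennreal (- m) \<partial>M)"
    unfolding B_def
  proof (rule nn_integral_mono)
    fix \<omega>
    have "- W \<omega> \<le> ereal (- m)" using m[of \<omega>] by (simp add: ereal_minus_le_minus flip: uminus_ereal.simps)
    then show "e2ennreal (- W \<omega>) \<le> ennreal (- m)"
      using e2ennreal_mono by fastforce
  qed
  then have "B \<le> ennreal (- m)" by (simp add: emeasure_space_1)
  then obtain b where b: "B = ennreal b" "b \<ge> 0"
    by (metis ennreal_cases ennreal_neq_top top.extremum_uniqueI)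
  have "enn2ereal A - enn2ereal B = enn2ereal G + ereal m"
  proof (cases "m \<ge> 0")
    case True
    then have "B = 0" using \<open>B \<le> ennreal (- m)\<close> by (simp add: ennreal_neg)
    then show ?thesis using eq True
      by (simp add: plus_ennreal.rep_eq enn2ereal_ennreal ennreal_neg zero_ennreal.rep_eq)
  next
    case False
    then have "enn2ereal G + ereal b = enn2ereal A + ereal (- m)"
      using eq b by (simp add: plus_ennreal.rep_eq enn2ereal_ennreal ennreal_neg zero_ennreal.rep_eq)
    then show ?thesis using b
      by (cases "enn2ereal G"; cases "enn2ereal A") (auto simp: enn2ereal_ennreal)
  qed
  then show ?thesis by (simp add: ereal_expectation_def A_def B_def G_def)
qed

text \<open>At i = k the variable cancels and the entry is the constant \<open>c k\<close>.
  Truncating the whole maximum at \<open>m\<close> therefore amounts to raising that one constant to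
  at least \<open>m\<close>.\<close>

lemma Max_max_shift:
  fixes z c :: "'i \<Rightarrow> real"
  assumes "finite J" "k \<in> J"
  shows "Max ((\<lambda>i. max (z i + c i - z k) m) ` J) = Max ((\<lambda>i. (c(k := max (c k) m)) i + z i) ` J) - z k"
proof (rule antisym)
  let ?c = "c(k := max (c k) m)"
  have le: "?c i + z i \<le> Max ((\<lambda>i. ?c i + z i) ` J)" if "i \<in> J" for i
    using assms(1) that by simp
  have "max (z i + c i - z k) m \<le> Max ((\<lambda>i. ?c i + z i) ` J) - z k" if "i \<in> J" for i
    using le[OF that] le[OF assms(2)] by (auto split: if_splits)
  then show "Max ((\<lambda>i. max (z i + c i - z k) m) ` J) \<le> Max ((\<lambda>i. ?c i + z i) ` J) - z k"
    using assms by (subst Max_le_iff) auto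
  have le: "max (z i + c i - z k) m \<le> Max ((\<lambda>i. max (z i + c i - z k) m) ` J)" if "i \<in> J" for i
    using assms(1) that by (intro Max_ge) auto
  have "?c i + z i \<le> Max ((\<lambda>i. max (z i + c i - z k) m) ` J) + z k" if "i \<in> J" for i
    using le[OF that] by (cases "i = k") auto
  then have "Max ((\<lambda>i. ?c i + z i) ` J) \<le> Max ((\<lambda>i. max (z i + c i - z k) m) ` J) + z k"
    using assms by (subst Max_le_iff) auto
  then show "Max ((\<lambda>i. ?c i + z i) ` J) - z k \<le> Max ((\<lambda>i. max (z i + c i - z k) m) ` J)"
    by simp
qed

text \<open>Every index of \<open>I\<close> lies in some \<open>J n\<close>, and every finite
  maximum is attained at an index of \<open>I\<close>. Since all truncated values are at least
  \<open>m\<close>, subtracting \<open>m\<close> loses nothing in \<open>ennreal\<close>.\<close>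

lemma SUP_max_eq_SUP_Max:
  fixes z :: "'i \<Rightarrow> real" and J :: "nat \<Rightarrow> 'i set"
  assumes J: "\<And>n. finite (J n)" "\<And>n. J n \<noteq> {}" and I: "I = (\<Union>n. J n)"
  shows "e2ennreal (max (SUP i\<in>I. ereal (z i)) (ereal m) - ereal m)
       = (SUP n. ennreal (Max ((\<lambda>i. max (z i) m) ` J n) - m))"
proof (rule antisym)
  let ?W = "max (SUP i\<in>I. ereal (z i)) (ereal m)"
  let ?Y = "SUP n. ennreal (Max ((\<lambda>i. max (z i) m) ` J n) - m)"
  have "ereal (z i) \<le> enn2ereal ?Y + ereal m" if "i \<in> I" for i
  proof -
    obtain n where "i \<in> J n" using \<open>i \<in> I\<close> I by blast
    then have "max (z i) m \<le> Max ((\<lambda>i. max (z i) m) ` J n)" using J(1) by (intro Max_ge) auto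
    then have "ennreal (max (z i) m - m) \<le> ?Y"
      by (intro SUP_upper2[of n] ennreal_leI) auto
    then have "enn2ereal (ennreal (max (z i) m - m)) \<le> enn2ereal ?Y"
      by (simp add: less_eq_ennreal.rep_eq)
    moreover define y where "y = enn2ereal ?Y"
    ultimately have "ereal (max (z i) m - m) \<le> y"
      by (simp add: enn2ereal_ennreal)
    then have "ereal (z i) \<le> y + ereal m"
      by (cases y) auto
    then show ?thesis by (simp only: y_def)
  qed
  moreover have "ereal m \<le> enn2ereal ?Y + ereal m"
    using add_right_mono[OF enn2ereal_nonneg[of ?Y], of "ereal m"] by (simp only: add_0)
  ultimately have "?W \<le> enn2ereal ?Y + ereal m"
    by (auto intro: SUP_least)
  then have "?W - ereal m \<le> enn2ereal ?Y"
    by (simp add: ereal_minus_le)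
  then show "e2ennreal (?W - ereal m) \<le> ?Y"
    using e2ennreal_mono by fastforce
  show "?Y \<le> e2ennreal (?W - ereal m)"
  proof (rule SUP_least)
    fix n
    have "Max ((\<lambda>i. max (z i) m) ` J n) \<in> (\<lambda>i. max (z i) m) ` J n"
      using J[of n] by (intro Max_in) auto
    then obtain i where i: "i \<in> J n" "Max ((\<lambda>i. max (z i) m) ` J n) = max (z i) m" by blast
    have "ereal (z i) \<le> (SUP i\<in>I. ereal (z i))" using i I by (intro SUP_upper) auto
    then have "max (ereal (z i)) (ereal m) \<le> ?W"
      by (rule max.mono[OF _ order_refl])
    then have "ereal (max (z i) m) \<le> ?W"
      by simp
    then have "ereal (max (z i) m) - ereal m \<le> ?W - ereal m"
      by (rule ereal_minus_mono) simp
    then have "ereal (max (z i) m - m) \<le> ?W - ereal m"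
      by (simp only: ereal_minus)
    then have "e2ennreal (ereal (max (z i) m - m)) \<le> e2ennreal (?W - ereal m)"
      by (rule e2ennreal_mono)
    then show "ennreal (Max ((\<lambda>i. max (z i) m) ` J n) - m) \<le> e2ennreal (?W - ereal m)"
      by (simp add: i(2))
  qed
qed

lemma gaussian_vector_of_process:
  assumes "prob_space M" "mean_zero_gaussian_process M I X" "finite J" "J \<subseteq> I"
  shows "gaussian_vector M J X"
  using assms by (simp add: gaussian_vector_def gaussian_vector_axioms_def mean_zero_gaussian_process_def)

text \<open>After the shift, \<open>X k\<close> is subtracted outside the maximum and has mean zero.
  What remains is a maximum with modified constants that do not depend on the process, so
  \<open>expectation_Max_le\<close> can compare two processes.\<close>

lemma (in gaussian_vector)
  assumes k: "k \<in> J"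
  shows integrable_Max_max: "integrable M (\<lambda>\<omega>. Max ((\<lambda>i. max (X i \<omega> + c i - X k \<omega>) m) ` J))"
    and expectation_Max_max: "expectation (\<lambda>\<omega>. Max ((\<lambda>i. max (X i \<omega> + c i - X k \<omega>) m) ` J))
      = expectation (\<lambda>\<omega>. Max ((\<lambda>i. (c(k := max (c k) m)) i + X i \<omega>) ` J))"
proof -
  have J: "J \<noteq> {}" using k by auto
  note i = integrable_Max[OF J, of "c(k := max (c k) m)"]
    centered_gaussian_integrable[OF prob_space_axioms gaussian_component[OF k]]
  have shift: "Max ((\<lambda>i. max (X i \<omega> + c i - X k \<omega>) m) ` J)
      = Max ((\<lambda>i. (c(k := max (c k) m)) i + X i \<omega>) ` J) - X k \<omega>" for \<omega>
    by (rule Max_max_shift[OF finite_index k, of "\<lambda>i. X i \<omega>"])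
  show "integrable M (\<lambda>\<omega>. Max ((\<lambda>i. max (X i \<omega> + c i - X k \<omega>) m) ` J))"
    unfolding shift by (intro Bochner_Integration.integrable_diff i)
  show "expectation (\<lambda>\<omega>. Max ((\<lambda>i. max (X i \<omega> + c i - X k \<omega>) m) ` J))
      = expectation (\<lambda>\<omega>. Max ((\<lambda>i. (c(k := max (c k) m)) i + X i \<omega>) ` J))"
    unfolding shift Bochner_Integration.integral_diff[OF i]
    by (simp add: centered_gaussian_expectation[OF prob_space_axioms gaussian_component[OF k]])
qed

text \<open>The process enters the right-hand side only through expected finite maxima, and
  monotonically, so a comparison for each \<open>J n\<close> carries over. The formula results from
  subtracting \<open>m\<close> and applying monotone convergence along the increasing sets
  \<open>J n\<close>.\<close>

lemma ereal_expectation_eq_SUP: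
  fixes J :: "nat \<Rightarrow> 'i set"
  assumes M: "prob_space M" and X: "mean_zero_gaussian_process M I X" and I: "countable I"
    and J: "\<And>n. finite (J n)" "\<And>n. k \<in> J n" "incseq J" "I = (\<Union>n. J n)"
  shows "ereal_expectation M (\<lambda>\<omega>. max (SUP i\<in>I. ereal (X i \<omega> + c i - X k \<omega>)) (ereal m))
    = enn2ereal (SUP n. ennreal (integral\<^sup>L M (\<lambda>\<omega>. Max ((\<lambda>i. (c(k := max (c k) m)) i + X i \<omega>) ` J n)) - m)) + ereal m"
proof -
  interpret prob_space M by fact
  have G: "gaussian_vector M (J n) X" for n
    using J by (intro gaussian_vector_of_process[OF M X]) auto
  have Xm: "X i \<in> borel_measurable M" if i: "i \<in> I" for i
  proof -
    obtain n where "i \<in> J n" using i J(4) by auto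
    then show ?thesis by (rule gaussian_vector.component_measurable[OF G])
  qed
  have k: "k \<in> I" using J(2,4) by auto
  let ?Z = "\<lambda>n \<omega>. Max ((\<lambda>i. max (X i \<omega> + c i - X k \<omega>) m) ` J n)"
  have int: "integrable M (?Z n)" for n
    by (rule gaussian_vector.integrable_Max_max[OF G J(2)])
  have meas: "(\<lambda>\<omega>. max (SUP i\<in>I. ereal (X i \<omega> + c i - X k \<omega>)) (ereal m)) \<in> borel_measurable M"
    using I Xm k by (intro borel_measurable_max borel_measurable_SUP borel_measurable_ereal
        borel_measurable_diff borel_measurable_add) auto
  have ge: "m \<le> ?Z n \<omega>" for n \<omega>
    using J(1)[of n] J(2)[of n] by (subst Max_ge_iff) (auto intro!: bexI[of _ k])
  have mono: "incseq (\<lambda>n \<omega>. ennreal (?Z n \<omega> - m))"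
    unfolding incseq_def le_fun_def
  proof (intro allI impI ennreal_leI diff_right_mono Max_mono image_mono)
    fix p q :: nat assume "p \<le> q"
    then show "J p \<subseteq> J q" using J(3) by (auto simp: incseq_def)
  qed (use J in auto)
  have "(\<integral>\<^sup>+\<omega>. e2ennreal (max (SUP i\<in>I. ereal (X i \<omega> + c i - X k \<omega>)) (ereal m) - ereal m) \<partial>M)
      = (\<integral>\<^sup>+\<omega>. (SUP n. ennreal (?Z n \<omega> - m)) \<partial>M)"
    using J by (subst SUP_max_eq_SUP_Max[where J = J]) auto
  also have "\<dots> = (SUP n. \<integral>\<^sup>+\<omega>. ennreal (?Z n \<omega> - m) \<partial>M)"
    using int by (intro nn_integral_monotone_convergence_SUP mono) auto
  also have "\<dots> = (SUP n. ennreal (expectation (?Z n) - m))"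
  proof (intro SUP_cong refl)
    fix n
    have "(\<integral>\<^sup>+\<omega>. ennreal (?Z n \<omega> - m) \<partial>M) = ennreal (expectation (\<lambda>\<omega>. ?Z n \<omega> - m))"
      using int ge by (intro nn_integral_eq_integral) auto
    then show "(\<integral>\<^sup>+\<omega>. ennreal (?Z n \<omega> - m) \<partial>M) = ennreal (expectation (?Z n) - m)"
      using int by (simp add: prob_space)
  qed
  finally show ?thesis
    unfolding gaussian_vector.expectation_Max_max[OF G J(2)]
    by (subst ereal_expectation_bounded_below[OF M meas, where m = m]) auto
qed

theorem mainTheorem2:
  fixes I :: "'i set"
    and M :: "'a measure" and N :: "'b measure"
    and X :: "'i \<Rightarrow> 'a \<Rightarrow> real" and Y :: "'i \<Rightarrow> 'b \<Rightarrow> real"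
    and c :: "'i \<Rightarrow> real" and m :: real and k :: 'i
  assumes "countable I" and "I \<noteq> {}"
    and "prob_space M" and "prob_space N"
    and "mean_zero_gaussian_process M I X"
    and "mean_zero_gaussian_process N I Y"
    and "\<And>i j. i \<in> I \<Longrightarrow> j \<in> I \<Longrightarrow>
           prob_space.expectation M (\<lambda>\<omega>. (X i \<omega> - X j \<omega>)\<^sup>2)
             \<le> prob_space.expectation N (\<lambda>\<omega>. (Y i \<omega> - Y j \<omega>)\<^sup>2)"
    and "k \<in> I"
  shows "ereal_expectation M (\<lambda>\<omega>. max (SUP i\<in>I. ereal (X i \<omega> + c i - X k \<omega>)) (ereal m))
           \<le> ereal_expectation N (\<lambda>\<omega>. max (SUP i\<in>I. ereal (Y i \<omega> + c i - Y k \<omega>)) (ereal m))"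
proof -
  \<comment> \<open>\<open>from_nat_into I\<close> enumerates \<open>I\<close>, with repetitions if
    \<open>I\<close> is finite. Inserting \<open>k\<close> in every set keeps the reference index
    available from the start.\<close>
  define J where "J n = insert k (from_nat_into I ` {..n})" for n
  have J: "finite (J n)" "k \<in> J n" for n by (auto simp: J_def)
  have inc: "incseq J" unfolding J_def by (auto simp: incseq_def)
  have I: "I = (\<Union>n. J n)"
    using range_from_nat_into[OF \<open>I \<noteq> {}\<close> \<open>countable I\<close>] \<open>k \<in> I\<close> by (auto simp: J_def)
  let ?E = "\<lambda>P Z n. integral\<^sup>L P (\<lambda>\<omega>. Max ((\<lambda>i. (c(k := max (c k) m)) i + Z i \<omega>) ` J n))"
  have le: "?E M X n \<le> ?E N Y n" for n
  proof -
    have sub: "J n \<subseteq> I" using I by auto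
    interpret M: gaussian_vector M "J n" X
      by (rule gaussian_vector_of_process[OF assms(3,5) J(1) sub])
    interpret N: gaussian_vector N "J n" Y
      by (rule gaussian_vector_of_process[OF assms(4,6) J(1) sub])
    interpret gaussian_comparison M N "J n" X Y
      using J(2)[of n] sub assms(7) by unfold_locales auto
    show ?thesis by (rule expectation_Max_le)
  qed
  show ?thesis
    unfolding ereal_expectation_eq_SUP[OF assms(3,5,1) J inc I] ereal_expectation_eq_SUP[OF assms(4,6,1) J inc I]
    using le by (intro add_right_mono) (auto simp flip: less_eq_ennreal.rep_eq intro!: SUP_mono' ennreal_leI)
qed

end
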